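(* Let $\Bbbk$ be a field of characteristic $0$, and let $\widehat{\lambda}_0,\widehat\lambda_1:U(W)\to R[v^{-1}]$ be as in the context. Then $\ker\widehat{\lambda}_0=\ker\widehat{\lambda}_1$, and this ideal is not finitely generated as a left ideal of $U(W)$ and is not finitely generated as a right ideal of $U(W)$.
   Context: The Witt algebra $W$ is the Lie algebra over $\Bbbk$ with basis $\{e_n\}_{n\in\mathbb Z}$ and bracket $[e_n,e_m]=(m-n)e_{n+m}$; $U(W)$ is its universal enveloping algebra. $R$ (the Jordan plane) is the $\Bbbk$-algebra generated by $u,v$ subject to $uv-vu-v^2=0$; the element $v$ is normal in $R$ and $R[v^{-1}]$ is the localization of $R$ inverting $v$. For $a\in\Bbbk$, $\widehat\lambda_a: U(W)\to R[v^{-1}]$ is the (well-defined) algebra homomorphism with $\widehat\lambda_a(e_n)=(u-(n-1)av)v^{n-1}$ for all $n\in\mathbb Z$. *)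

theory Defs
  imports Complex_Main "HOL.Hull" "HOL-Library.Poly_Mapping"
begin

section \<open>Ideals of noncommutative rings\<close>

definition left_ideal :: "'a::ring_1 set \<Rightarrow> bool" where
  "left_ideal I \<longleftrightarrow> 0 \<in> I \<and> (\<forall>x\<in>I. \<forall>y\<in>I. x + y \<in> I) \<and> (\<forall>r. \<forall>x\<in>I. r * x \<in> I)"

definition right_ideal :: "'a::ring_1 set \<Rightarrow> bool" where
  "right_ideal I \<longleftrightarrow> 0 \<in> I \<and> (\<forall>x\<in>I. \<forall>y\<in>I. x + y \<in> I) \<and> (\<forall>r. \<forall>x\<in>I. x * r \<in> I)"

definition two_sided_ideal :: "'a::ring_1 set \<Rightarrow> bool" where
  "two_sided_ideal I \<longleftrightarrow> left_ideal I \<and> right_ideal I"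

definition fin_gen_left_ideal :: "'a::ring_1 set \<Rightarrow> bool" where
  "fin_gen_left_ideal I \<longleftrightarrow> (\<exists>S. finite S \<and> I = left_ideal hull S)"

definition fin_gen_right_ideal :: "'a::ring_1 set \<Rightarrow> bool" where
  "fin_gen_right_ideal I \<longleftrightarrow> (\<exists>S. finite S \<and> I = right_ideal hull S)"

lemma two_sided_ideal_hull: "two_sided_ideal (two_sided_ideal hull S)"
  by (rule hull_in) (auto simp: two_sided_ideal_def left_ideal_def right_ideal_def)

context
  fixes I :: "'a::ring_1 set"
  assumes I: "two_sided_ideal I"
begin

lemma ideal_0: "0 \<in> I"
  using I by (auto simp: two_sided_ideal_def left_ideal_def)

lemma ideal_add: "x \<in> I \<Longrightarrow> y \<in> I \<Longrightarrow> x + y \<in> I"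
  using I by (auto simp: two_sided_ideal_def left_ideal_def)

lemma ideal_lmult: "x \<in> I \<Longrightarrow> r * x \<in> I"
  using I by (auto simp: two_sided_ideal_def left_ideal_def)

lemma ideal_rmult: "x \<in> I \<Longrightarrow> x * r \<in> I"
  using I by (auto simp: two_sided_ideal_def right_ideal_def)

lemma ideal_uminus: "x \<in> I \<Longrightarrow> - x \<in> I"
  using ideal_lmult[of x "- 1"] by simp

lemma ideal_equivp: "equivp (\<lambda>x y. x - y \<in> I)"
proof (rule equivpI)
  show "reflp (\<lambda>x y. x - y \<in> I)"
    by (rule reflpI) (simp add: ideal_0)
  show "symp (\<lambda>x y. x - y \<in> I)"
    by (rule sympI) (use ideal_uminus in fastforce)
  show "transp (\<lambda>x y. x - y \<in> I)"
    by (rule transpI) (use ideal_add in fastforce)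
qed

lemma ideal_cong_add: "x - x' \<in> I \<Longrightarrow> y - y' \<in> I \<Longrightarrow> x + y - (x' + y') \<in> I"
  using ideal_add[of "x - x'" "y - y'"] by (simp add: algebra_simps)

lemma ideal_cong_uminus: "x - x' \<in> I \<Longrightarrow> - x - - x' \<in> I"
  using ideal_uminus[of "x - x'"] by simp

lemma ideal_cong_minus: "x - x' \<in> I \<Longrightarrow> y - y' \<in> I \<Longrightarrow> x - y - (x' - y') \<in> I"
  using ideal_add[of "x - x'" "- (y - y')"] ideal_uminus[of "y - y'"]
  by (simp add: algebra_simps)

lemma ideal_cong_mult: "x - x' \<in> I \<Longrightarrow> y - y' \<in> I \<Longrightarrow> x * y - x' * y' \<in> I"
  using ideal_add[of "(x - x') * y" "x' * (y - y')"] ideal_rmult[of "x - x'" y]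
    ideal_lmult[of "y - y'" x'] by (simp add: algebra_simps)

end


section \<open>Algebras over a field and free algebras\<close>

text \<open>An associative unital algebra over \<open>'k\<close> is a ring together with a ring homomorphism
  \<open>'k \<Rightarrow> 'a\<close> into its centre.\<close>

locale algebra_struct =
  fixes \<kappa> :: "'k::field \<Rightarrow> 'a::ring_1"
  assumes add: "\<kappa> (c + d) = \<kappa> c + \<kappa> d"
    and mult: "\<kappa> (c * d) = \<kappa> c * \<kappa> d"
    and one: "\<kappa> 1 = 1"
    and central: "\<kappa> c * x = x * \<kappa> c"
begin

lemma zero: "\<kappa> 0 = 0"
  using add[of 0 0] by simp

lemma uminus: "\<kappa> (- c) = - \<kappa> c"
  using add[of c "- c"] by (simp add: zero eq_neg_iff_add_eq_0 add.commute)

lemma diff: "\<kappa> (c - d) = \<kappa> c - \<kappa> d"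
  using add[of c "- d"] uminus by simp

lemma left_central: "y * (\<kappa> c * x) = \<kappa> c * (y * x)"
  using central by (metis mult.assoc)

lemma of_int: "\<kappa> (of_int n) = of_int n"
proof -
  have nat: "\<kappa> (of_nat m) = of_nat m" for m
    by (induction m) (simp_all add: zero add one)
  show ?thesis
    by (cases n rule: int_diff_cases) (simp add: diff nat)
qed

end

definition algebra_hom ::
    "('k \<Rightarrow> 'a::ring_1) \<Rightarrow> ('k \<Rightarrow> 'b::ring_1) \<Rightarrow> ('a \<Rightarrow> 'b) \<Rightarrow> bool" where
  "algebra_hom \<kappa> \<kappa>' f \<longleftrightarrow> (\<forall>x y. f (x + y) = f x + f y) \<and> (\<forall>x y. f (x * y) = f x * f y)
     \<and> f 1 = 1 \<and> (\<forall>c. f (\<kappa> c) = \<kappa>' c)"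

datatype 'x free_monoid = FM (letters: "'x list")

instantiation free_monoid :: (type) monoid_add
begin
definition "0 = FM []"
definition "x + y = FM (letters x @ letters y)"
instance by standard (auto simp: zero_free_monoid_def plus_free_monoid_def)
end

lemma letters_zero [simp]: "letters 0 = []"
  and letters_plus [simp]: "letters (v + w) = letters v @ letters w"
  by (simp_all add: zero_free_monoid_def plus_free_monoid_def)

type_synonym ('k, 'x) free_algebra = "'x free_monoid \<Rightarrow>\<^sub>0 'k"

definition fa_const :: "'k::field \<Rightarrow> ('k, 'x) free_algebra" where
  "fa_const c = Poly_Mapping.single 0 c"

definition fa_gen :: "'x \<Rightarrow> ('k::field, 'x) free_algebra" where
  "fa_gen x = Poly_Mapping.single (FM [x]) 1"

lemma sum_keys_add:
  fixes x y :: "'n \<Rightarrow>\<^sub>0 'k::comm_monoid_add" and g :: "'n \<Rightarrow> 'k \<Rightarrow> 'a::comm_monoid_add"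
  assumes "\<And>n. g n 0 = 0" "\<And>n c d. g n (c + d) = g n c + g n d"
  shows "(\<Sum>n\<in>Poly_Mapping.keys (x + y). g n (Poly_Mapping.lookup (x + y) n))
    = (\<Sum>n\<in>Poly_Mapping.keys x. g n (Poly_Mapping.lookup x n)) + (\<Sum>n\<in>Poly_Mapping.keys y. g n (Poly_Mapping.lookup y n))"
  using setsum_keys_plus_distrib[of g x y] assms by auto

lemma poly_mapping_sum_single: "(\<Sum>n\<in>Poly_Mapping.keys x. Poly_Mapping.single n (Poly_Mapping.lookup x n)) = x"
  by (rule poly_mapping_eqI)
     (auto simp: lookup_sum lookup_single when_def in_keys_iff)

lemma poly_mapping_add_induct [case_names single add]:
  assumes "\<And>n c. P (Poly_Mapping.single n c)" and "\<And>x y. P x \<Longrightarrow> P y \<Longrightarrow> P (x + y)"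
  shows "P (x :: 'n \<Rightarrow>\<^sub>0 'k::comm_monoid_add)"
proof -
  have "P (\<Sum>n\<in>A. Poly_Mapping.single n (Poly_Mapping.lookup x n))" if "finite A" for A
    using that
  proof (induction A)
    case empty
    show ?case using assms(1)[of undefined 0] by simp
  qed (simp add: assms)
  from this[of "Poly_Mapping.keys x"] show ?thesis
    by (simp add: poly_mapping_sum_single)
qed

definition linear_ext :: "('k::field \<Rightarrow> 'a::ring_1) \<Rightarrow> ('n \<Rightarrow> 'a) \<Rightarrow> ('n \<Rightarrow>\<^sub>0 'k) \<Rightarrow> 'a" where
  "linear_ext \<kappa> g x = (\<Sum>n\<in>Poly_Mapping.keys x. \<kappa> (Poly_Mapping.lookup x n) * g n)"

definition free_lift :: "('k::field \<Rightarrow> 'a::ring_1) \<Rightarrow> ('x \<Rightarrow> 'a) \<Rightarrow> ('k, 'x) free_algebra \<Rightarrow> 'a" where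
  "free_lift \<kappa> f = linear_ext \<kappa> (\<lambda>w. prod_list (map f (letters w)))"

context algebra_struct
begin

lemma linear_ext_single [simp]: "linear_ext \<kappa> g (Poly_Mapping.single n c) = \<kappa> c * g n"
  by (simp add: linear_ext_def zero)

lemma linear_ext_add: "linear_ext \<kappa> g (x + y) = linear_ext \<kappa> g x + linear_ext \<kappa> g y"
  unfolding linear_ext_def
  by (rule sum_keys_add[of "\<lambda>n c. \<kappa> c * g n"]) (simp_all add: zero add distrib_right)

lemma linear_ext_scale:
  "linear_ext \<kappa> g (Poly_Mapping.map ((*) c) x) = \<kappa> c * linear_ext \<kappa> g x"
proof (induction x rule: poly_mapping_add_induct)
  case (add x y)
  have "Poly_Mapping.map ((*) c) (x + y) = Poly_Mapping.map ((*) c) x + Poly_Mapping.map ((*) c) y"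
    by (rule poly_mapping_eqI) (auto simp: lookup_add Poly_Mapping.map.rep_eq when_def simp flip: distrib_left)
  with add show ?case by (simp add: linear_ext_add distrib_left)
qed (simp add: mult mult.assoc)

lemma free_lift_add: "free_lift \<kappa> f (p + q) = free_lift \<kappa> f p + free_lift \<kappa> f q"
  by (simp add: free_lift_def linear_ext_add)

lemma free_lift_const [simp]: "free_lift \<kappa> f (fa_const c) = \<kappa> c"
  by (simp add: free_lift_def fa_const_def zero)

lemma free_lift_0 [simp]: "free_lift \<kappa> f 0 = 0"
  using free_lift_const[of f 0] by (simp add: fa_const_def zero)

lemma free_lift_1 [simp]: "free_lift \<kappa> f 1 = 1"
  using free_lift_const[of f 1] by (simp add: fa_const_def one)

lemma free_lift_gen [simp]: "free_lift \<kappa> f (fa_gen x) = f x"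
  by (simp add: free_lift_def fa_gen_def one)

lemma free_lift_diff: "free_lift \<kappa> f (p - q) = free_lift \<kappa> f p - free_lift \<kappa> f q"
  using free_lift_add[of f "p - q" q] by (simp add: algebra_simps)

lemma free_lift_mult: "free_lift \<kappa> f (p * q) = free_lift \<kappa> f p * free_lift \<kappa> f q"
proof (induction p rule: poly_mapping_add_induct)
  case (single v c)
  show ?case
  proof (induction q rule: poly_mapping_add_induct)
    case (single w d)
    let ?f = "\<lambda>w. prod_list (map f (letters w))"
    have "\<kappa> c * \<kappa> d * (?f v * ?f w) = \<kappa> c * ?f v * (\<kappa> d * ?f w)"
      using left_central[of "?f v" d "?f w"] by (simp add: mult.assoc)
    then show ?case
      by (simp add: free_lift_def mult_single mult)
  qed (simp add: free_lift_add distrib_left)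
qed (simp add: free_lift_add distrib_right)

lemma algebra_hom_free_lift: "algebra_hom fa_const \<kappa> (free_lift \<kappa> f)"
  by (simp add: algebra_hom_def free_lift_add free_lift_mult)

lemma free_lift_ideal:
  assumes "\<And>p. p \<in> S \<Longrightarrow> free_lift \<kappa> f p = 0" and "p \<in> two_sided_ideal hull S"
  shows "free_lift \<kappa> f p = 0"
  using assms(2,1)
  by (rule hull_induct)
     (simp_all add: two_sided_ideal_def left_ideal_def right_ideal_def free_lift_add free_lift_mult)

lemma free_lift_cong:
  assumes "\<And>p. p \<in> S \<Longrightarrow> free_lift \<kappa> f p = 0" and "p - q \<in> two_sided_ideal hull S"
  shows "free_lift \<kappa> f p = free_lift \<kappa> f q"
  using free_lift_ideal[OF assms] by (simp add: free_lift_diff)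

end

lemma algebra_struct_id: "algebra_struct (\<lambda>c::'k::field. c)"
  by unfold_locales (simp_all add: mult.commute)

lemma algebra_struct_fa_const: "algebra_struct (fa_const :: 'k::field \<Rightarrow> ('k, 'x) free_algebra)"
proof
  fix c :: 'k and x :: "('k, 'x) free_algebra"
  show "fa_const c * x = x * fa_const c"
    by (induction x rule: poly_mapping_add_induct)
       (simp_all add: fa_const_def mult_single distrib_left distrib_right mult.commute)
qed (simp_all add: fa_const_def single_add mult_single)


lemma fa_const_hull:
  "fa_const (c + d) - (fa_const c + fa_const d) \<in> two_sided_ideal hull S"
  "fa_const (c * d) - fa_const c * fa_const d \<in> two_sided_ideal hull S"
  "fa_const 1 - 1 \<in> two_sided_ideal hull S"
  "fa_const c * x - x * fa_const c \<in> two_sided_ideal hull S"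
proof -
  interpret algebra_struct fa_const by (rule algebra_struct_fa_const)
  show "fa_const (c + d) - (fa_const c + fa_const d) \<in> two_sided_ideal hull S"
    by (simp only: add diff_self ideal_0[OF two_sided_ideal_hull])
  show "fa_const (c * d) - fa_const c * fa_const d \<in> two_sided_ideal hull S"
    by (simp only: mult diff_self ideal_0[OF two_sided_ideal_hull])
  show "fa_const 1 - 1 \<in> two_sided_ideal hull S"
    by (simp only: one diff_self ideal_0[OF two_sided_ideal_hull])
  show "fa_const c * x - x * fa_const c \<in> two_sided_ideal hull S"
    by (simp only: central[of c x] diff_self ideal_0[OF two_sided_ideal_hull])
qed


section \<open>The Witt algebra\<close>

locale lie_algebra = vector_space scale
  for scale :: "'k::field \<Rightarrow> 'g::ab_group_add \<Rightarrow> 'g" +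
  fixes bracket :: "'g \<Rightarrow> 'g \<Rightarrow> 'g"
  assumes bracket_add_left: "bracket (x + y) z = bracket x z + bracket y z"
    and bracket_add_right: "bracket x (y + z) = bracket x y + bracket x z"
    and bracket_scale_left: "bracket (scale c x) y = scale c (bracket x y)"
    and bracket_scale_right: "bracket x (scale c y) = scale c (bracket x y)"
    and bracket_self: "bracket x x = 0"
    and jacobi: "bracket x (bracket y z) + bracket y (bracket z x) + bracket z (bracket x y) = 0"

text \<open>Finitely supported functions \<open>\<int> \<Rightarrow> 'k\<close>; the function supported at \<open>n\<close> with value
  \<open>1\<close> is the basis element \<open>e\<^sub>n\<close>. The convolution product that
  \<^theory>\<open>HOL-Library.Poly_Mapping\<close> puts on this type is not used.\<close>

type_synonym 'k witt = "int \<Rightarrow>\<^sub>0 'k"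

definition witt_e :: "int \<Rightarrow> 'k::field witt" where
  "witt_e n = Poly_Mapping.single n 1"

definition witt_scale :: "'k::field \<Rightarrow> 'k witt \<Rightarrow> 'k witt" where
  "witt_scale c = Poly_Mapping.map ((*) c)"

definition witt_bracket :: "'k::field witt \<Rightarrow> 'k witt \<Rightarrow> 'k witt" where
  "witt_bracket x y = (\<Sum>n\<in>Poly_Mapping.keys x. \<Sum>m\<in>Poly_Mapping.keys y.
     Poly_Mapping.single (n + m) (of_int (m - n) * Poly_Mapping.lookup x n * Poly_Mapping.lookup y m))"

lemma lookup_witt_scale [simp]: "Poly_Mapping.lookup (witt_scale c x) n = c * Poly_Mapping.lookup x n"
  by (simp add: witt_scale_def Poly_Mapping.map.rep_eq when_def)

lemma witt_scale_add: "witt_scale c (x + y) = witt_scale c x + witt_scale c y"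
  by (rule poly_mapping_eqI) (simp add: lookup_add distrib_left)

lemma witt_scale_single [simp]:
  "witt_scale c (Poly_Mapping.single n d) = Poly_Mapping.single n (c * d)"
  by (simp add: witt_scale_def)

lemma witt_bracket_single [simp]:
  "witt_bracket (Poly_Mapping.single n a) (Poly_Mapping.single m b)
     = Poly_Mapping.single (n + m) (of_int (m - n) * a * b)"
  by (simp add: witt_bracket_def)

lemma witt_bracket_e: "witt_bracket (witt_e n) (witt_e m) = witt_scale (of_int (m - n)) (witt_e (n + m))"
  by (simp add: witt_e_def)

lemma witt_bracket_add_left: "witt_bracket (x + y) z = witt_bracket x z + witt_bracket y z"
  unfolding witt_bracket_def
  by (rule sum_keys_add[where g = "\<lambda>n c. \<Sum>m\<in>Poly_Mapping.keys z.
       Poly_Mapping.single (n + m) (of_int (m - n) * c * Poly_Mapping.lookup z m)"])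
     (simp_all add: single_add[symmetric] sum.distrib[symmetric] algebra_simps)

lemma witt_bracket_alt: "witt_bracket x y = - witt_bracket y x"
  unfolding witt_bracket_def
  by (subst sum.swap) (simp add: sum_negf[symmetric] single_uminus[symmetric] algebra_simps)

lemma witt_bracket_add_right: "witt_bracket x (y + z) = witt_bracket x y + witt_bracket x z"
  using witt_bracket_add_left[of y z x] witt_bracket_alt[of x] by simp

lemma witt_bracket_scale_left: "witt_bracket (witt_scale c x) y = witt_scale c (witt_bracket x y)"
proof (induction x rule: poly_mapping_add_induct)
  case (single n a)
  show ?case
    by (induction y rule: poly_mapping_add_induct)
       (simp_all add: witt_bracket_add_right witt_scale_add mult_ac)
qed (simp add: witt_bracket_add_left witt_scale_add)

lemma witt_bracket_self: "witt_bracket x x = 0"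
proof (induction x rule: poly_mapping_add_induct)
  case (add x y)
  then show ?case
    using witt_bracket_alt[of x y] by (simp add: witt_bracket_add_left witt_bracket_add_right)
qed simp

lemma witt_jacobi: "witt_bracket x (witt_bracket y z) + witt_bracket y (witt_bracket z x)
    + witt_bracket z (witt_bracket x y) = 0"
proof -
  define J :: "'a witt \<Rightarrow> 'a witt \<Rightarrow> 'a witt \<Rightarrow> 'a witt" where
    "J x y z = witt_bracket x (witt_bracket y z) + witt_bracket y (witt_bracket z x)
      + witt_bracket z (witt_bracket x y)" for x y z
  have add: "J (x + x') y z = J x y z + J x' y z" "J x (y + y') z = J x y z + J x y' z"
    "J x y (z + z') = J x y z + J x y z'" for x x' y y' z z'
    by (simp_all add: J_def witt_bracket_add_left witt_bracket_add_right add_ac)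
  have single: "J (Poly_Mapping.single n a) (Poly_Mapping.single m b) (Poly_Mapping.single l c) = 0"
    for n m l a b c
    by (simp add: J_def single_add[symmetric] add_ac) (simp add: algebra_simps)
  have "J (Poly_Mapping.single n a) (Poly_Mapping.single m b) z = 0" for n m a b z
    by (induction z rule: poly_mapping_add_induct) (simp_all add: add single)
  then have "J (Poly_Mapping.single n a) y z = 0" for n a y z
    by (induction y rule: poly_mapping_add_induct) (simp_all add: add)
  then have "J x y z = 0"
    by (induction x rule: poly_mapping_add_induct) (simp_all add: add)
  then show ?thesis by (simp add: J_def)
qed

interpretation witt: lie_algebra "witt_scale :: 'k::field \<Rightarrow> 'k witt \<Rightarrow> 'k witt" witt_bracket
proof
  fix c :: 'k and x y :: "'k witt"
  show "witt_bracket x (witt_scale c y) = witt_scale c (witt_bracket x y)"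
    using witt_bracket_scale_left[of c y x] witt_bracket_alt[of x]
    by (simp add: poly_mapping_eq_iff fun_eq_iff)
qed (simp_all add: witt_bracket_add_left witt_bracket_add_right witt_bracket_scale_left
      witt_bracket_self witt_jacobi witt_scale_add poly_mapping_eq_iff[of "witt_scale _ _"]
      lookup_add fun_eq_iff distrib_right)


section \<open>The universal enveloping algebra\<close>

text \<open>The first two families of relations turn the free algebra on the underlying set of a Lie
  algebra into its tensor algebra.\<close>

definition enveloping_relations ::
    "('k::field \<Rightarrow> 'g::ab_group_add \<Rightarrow> 'g) \<Rightarrow> ('g \<Rightarrow> 'g \<Rightarrow> 'g) \<Rightarrow> ('k, 'g) free_algebra set" where
  "enveloping_relations scale bracket =
     {fa_gen (x + y) - (fa_gen x + fa_gen y) | x y. True}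
   \<union> {fa_gen (scale c x) - fa_const c * fa_gen x | c x. True}
   \<union> {fa_gen x * fa_gen y - fa_gen y * fa_gen x - fa_gen (bracket x y) | x y. True}"

lemma enveloping_relations_cases [consumes 1]:
  assumes "p \<in> enveloping_relations scale bracket"
  obtains x y where "p = fa_gen (x + y) - (fa_gen x + fa_gen y)"
  | c x where "p = fa_gen (scale c x) - fa_const c * fa_gen x"
  | x y where "p = fa_gen x * fa_gen y - fa_gen y * fa_gen x - fa_gen (bracket x y)"
  using assms unfolding enveloping_relations_def by blast

quotient_type (overloaded) 'k U_witt = "('k::field, 'k witt) free_algebra" /
  "\<lambda>p q. p - q \<in> two_sided_ideal hull (enveloping_relations witt_scale witt_bracket)"
  by (intro ideal_equivp two_sided_ideal_hull)

instantiation U_witt :: (field) ring_1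
begin

lift_definition zero_U_witt :: "'a U_witt" is 0 .
lift_definition one_U_witt :: "'a U_witt" is 1 .
lift_definition plus_U_witt :: "'a U_witt \<Rightarrow> 'a U_witt \<Rightarrow> 'a U_witt" is "(+)"
  by (rule ideal_cong_add[OF two_sided_ideal_hull])
lift_definition uminus_U_witt :: "'a U_witt \<Rightarrow> 'a U_witt" is uminus
  by (rule ideal_cong_uminus[OF two_sided_ideal_hull])
lift_definition minus_U_witt :: "'a U_witt \<Rightarrow> 'a U_witt \<Rightarrow> 'a U_witt" is "(-)"
  by (rule ideal_cong_minus[OF two_sided_ideal_hull])
lift_definition times_U_witt :: "'a U_witt \<Rightarrow> 'a U_witt \<Rightarrow> 'a U_witt" is "(*)"
  by (rule ideal_cong_mult[OF two_sided_ideal_hull])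

instance
proof
  show "(0::'a U_witt) \<noteq> 1"
  proof (transfer, rule notI)
    interpret algebra_struct "\<lambda>c::'a. c" by (rule algebra_struct_id)
    assume "(0::('a, 'a witt) free_algebra) - 1
      \<in> two_sided_ideal hull (enveloping_relations witt_scale witt_bracket)"
    then have "free_lift (\<lambda>c::'a. c) (\<lambda>_. 0) (0::('a, 'a witt) free_algebra)
        = free_lift (\<lambda>c. c) (\<lambda>_. 0) (1::('a, 'a witt) free_algebra)"
      by (rule free_lift_cong[rotated])
         (erule enveloping_relations_cases, simp_all add: free_lift_diff free_lift_add free_lift_mult)
    then show False by simp
  qed
qed (transfer, simp add: algebra_simps ideal_0[OF two_sided_ideal_hull])+

end

lift_definition ue_const :: "'k::field \<Rightarrow> 'k U_witt" is fa_const .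

definition ue_emb :: "'k::field witt \<Rightarrow> 'k U_witt" where
  "ue_emb x = abs_U_witt (fa_gen x)"

lemma algebra_struct_ue_const: "algebra_struct (ue_const :: 'k::field \<Rightarrow> 'k U_witt)"
  by unfold_locales
     (transfer, rule fa_const_hull)+


section \<open>The Jordan plane\<close>

datatype jordan_gen = GenU | GenV

definition jordan_relations :: "('k::field, jordan_gen) free_algebra set" where
  "jordan_relations = {fa_gen GenU * fa_gen GenV - fa_gen GenV * fa_gen GenU - fa_gen GenV ^ 2}"

quotient_type (overloaded) 'k jordan = "('k::field, jordan_gen) free_algebra" /
  "\<lambda>p q. p - q \<in> two_sided_ideal hull jordan_relations"
  by (intro ideal_equivp two_sided_ideal_hull)

instantiation jordan :: (field) ring_1
begin

lift_definition zero_jordan :: "'a jordan" is 0 .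
lift_definition one_jordan :: "'a jordan" is 1 .
lift_definition plus_jordan :: "'a jordan \<Rightarrow> 'a jordan \<Rightarrow> 'a jordan" is "(+)"
  by (rule ideal_cong_add[OF two_sided_ideal_hull])
lift_definition uminus_jordan :: "'a jordan \<Rightarrow> 'a jordan" is uminus
  by (rule ideal_cong_uminus[OF two_sided_ideal_hull])
lift_definition minus_jordan :: "'a jordan \<Rightarrow> 'a jordan \<Rightarrow> 'a jordan" is "(-)"
  by (rule ideal_cong_minus[OF two_sided_ideal_hull])
lift_definition times_jordan :: "'a jordan \<Rightarrow> 'a jordan \<Rightarrow> 'a jordan" is "(*)"
  by (rule ideal_cong_mult[OF two_sided_ideal_hull])

instance
proof
  show "(0::'a jordan) \<noteq> 1"
  proof (transfer, rule notI)
    interpret algebra_struct "\<lambda>c::'a. c" by (rule algebra_struct_id)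
    assume "(0::('a, jordan_gen) free_algebra) - 1 \<in> two_sided_ideal hull jordan_relations"
    then have "free_lift (\<lambda>c::'a. c) (\<lambda>_. 0) (0::('a, jordan_gen) free_algebra)
        = free_lift (\<lambda>c. c) (\<lambda>_. 0) (1::('a, jordan_gen) free_algebra)"
      by (rule free_lift_cong[rotated])
         (simp add: jordan_relations_def free_lift_diff free_lift_mult power2_eq_square)
    then show False by simp
  qed
qed (transfer, simp add: algebra_simps ideal_0[OF two_sided_ideal_hull])+

end

lift_definition jordan_const :: "'k::field \<Rightarrow> 'k jordan" is fa_const .

lift_definition jordan_u :: "'k::field jordan" is "fa_gen GenU" .

lift_definition jordan_v :: "'k::field jordan" is "fa_gen GenV" .

lemma algebra_struct_jordan_const: "algebra_struct (jordan_const :: 'k::field \<Rightarrow> 'k jordan)"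
  by unfold_locales
     (transfer, rule fa_const_hull)+

lemma jordan_relation:
  "(jordan_u :: 'k::field jordan) * jordan_v - jordan_v * jordan_u - jordan_v ^ 2 = 0"
  unfolding power2_eq_square
  by transfer (simp add: jordan_relations_def power2_eq_square hull_inc)


section \<open>Localization of the Jordan plane\<close>

text \<open>Adjoining to a \<open>'k\<close>-algebra with structure map \<open>\<kappa>\<close> a two-sided inverse of its element
  \<open>s\<close>: the generator \<open>Some r\<close> is the image of \<open>r\<close> and \<open>None\<close> is the inverse of \<open>s\<close>. By
  the universal property this is the Ore localization whenever the powers of \<open>s\<close> form a
  denominator set, e.g. for a nonzero normal element of a domain.\<close>

definition localization_relations ::
    "('k::field \<Rightarrow> 'r::ring_1) \<Rightarrow> 'r \<Rightarrow> ('k, 'r option) free_algebra set" where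
  "localization_relations \<kappa> s =
     {fa_gen (Some (x + y)) - (fa_gen (Some x) + fa_gen (Some y)) | x y. True}
   \<union> {fa_gen (Some (x * y)) - fa_gen (Some x) * fa_gen (Some y) | x y. True}
   \<union> {fa_gen (Some (\<kappa> c)) - fa_const c | c. True}
   \<union> {fa_gen (Some s) * fa_gen None - 1, fa_gen None * fa_gen (Some s) - 1}"

lemma localization_relations_cases [consumes 1]:
  assumes "p \<in> localization_relations \<kappa> s"
  obtains x y where "p = fa_gen (Some (x + y)) - (fa_gen (Some x) + fa_gen (Some y))"
  | x y where "p = fa_gen (Some (x * y)) - fa_gen (Some x) * fa_gen (Some y)"
  | c where "p = fa_gen (Some (\<kappa> c)) - fa_const c"
  | "p = fa_gen (Some s) * fa_gen None - 1"
  | "p = fa_gen None * fa_gen (Some s) - 1"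
  using assms unfolding localization_relations_def by blast

quotient_type (overloaded) 'k jordan_loc = "('k::field, 'k jordan option) free_algebra" /
  "\<lambda>p q. p - q \<in> two_sided_ideal hull (localization_relations jordan_const jordan_v)"
  by (intro ideal_equivp two_sided_ideal_hull)

text \<open>The localization is not the zero ring: it acts on the space with basis
  \<open>(t\<^sub>i)\<close>, \<open>i \<in> \<int>\<close>, by \<open>u t\<^sub>i = i t\<^sub>i\<^sub>+\<^sub>1\<close> and \<open>v t\<^sub>i = t\<^sub>i\<^sub>+\<^sub>1\<close>.\<close>

typedef (overloaded) 'k shift_op =
  "{f :: (int \<Rightarrow>\<^sub>0 'k::field) \<Rightarrow> (int \<Rightarrow>\<^sub>0 'k).
     (\<forall>x y. f (x + y) = f x + f y) \<and> (\<forall>c x. f (witt_scale c x) = witt_scale c (f x))}"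
  by (rule exI[of _ "\<lambda>x. x"]) simp

setup_lifting type_definition_shift_op

lemma witt_scale_simps:
  "witt_scale c 0 = 0" "witt_scale c (- x) = - witt_scale c x"
  "witt_scale c (x - y) = witt_scale c x - witt_scale c y"
  by (simp_all add: witt.scale_right_diff_distrib)

instantiation shift_op :: (field) ring_1
begin

lift_definition zero_shift_op :: "'a shift_op" is "\<lambda>x. 0" by (simp add: witt_scale_simps)
lift_definition one_shift_op :: "'a shift_op" is "\<lambda>x. x" by simp
lift_definition plus_shift_op :: "'a shift_op \<Rightarrow> 'a shift_op \<Rightarrow> 'a shift_op" is "\<lambda>f g x. f x + g x"
  by (simp add: witt_scale_add algebra_simps)
lift_definition uminus_shift_op :: "'a shift_op \<Rightarrow> 'a shift_op" is "\<lambda>f x. - f x"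
  by (simp add: witt_scale_simps)
lift_definition minus_shift_op :: "'a shift_op \<Rightarrow> 'a shift_op \<Rightarrow> 'a shift_op" is "\<lambda>f g x. f x - g x"
  by (simp add: witt_scale_simps)
lift_definition times_shift_op :: "'a shift_op \<Rightarrow> 'a shift_op \<Rightarrow> 'a shift_op" is "\<lambda>f g x. f (g x)"
  by simp

instance
proof
  show "(0::'a shift_op) \<noteq> 1"
    by transfer (auto simp: fun_eq_iff intro!: exI[of _ "Poly_Mapping.single 0 1"])
qed (transfer, auto simp: fun_eq_iff)+

end

lift_definition shift_const :: "'k::field \<Rightarrow> 'k shift_op" is witt_scale
  by (simp add: witt_scale_add mult.commute)

lemma algebra_struct_shift_const: "algebra_struct (shift_const :: 'k::field \<Rightarrow> 'k shift_op)"
  by unfold_locales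
     (transfer, auto simp: fun_eq_iff witt.scale_left_distrib)+

definition shift_by :: "int \<Rightarrow> (int \<Rightarrow> 'k::field) \<Rightarrow> (int \<Rightarrow>\<^sub>0 'k) \<Rightarrow> (int \<Rightarrow>\<^sub>0 'k)" where
  "shift_by d g x = (\<Sum>n\<in>Poly_Mapping.keys x. Poly_Mapping.single (n + d) (g n * Poly_Mapping.lookup x n))"

lemma shift_by_single [simp]:
  "shift_by d g (Poly_Mapping.single n c) = Poly_Mapping.single (n + d) (g n * c)"
  by (simp add: shift_by_def)

lemma shift_by_add: "shift_by d g (x + y) = shift_by d g x + shift_by d g y"
  unfolding shift_by_def
  by (rule sum_keys_add[where g = "\<lambda>n c. Poly_Mapping.single (n + d) (g n * c)"])
     (simp_all add: single_add[symmetric] distrib_left)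

lift_definition shift_weighted :: "int \<Rightarrow> (int \<Rightarrow> 'k::field) \<Rightarrow> 'k shift_op" is shift_by
proof (intro conjI allI)
  fix d and g :: "int \<Rightarrow> 'k" and c x
  show "shift_by d g (witt_scale c x) = witt_scale c (shift_by d g x)"
    by (induction x rule: poly_mapping_add_induct)
       (simp_all add: witt_scale_add shift_by_add mult_ac)
qed (rule shift_by_add)

lemma shift_weighted_mult:
  "shift_weighted d g * shift_weighted d' g' = shift_weighted (d' + d) (\<lambda>n. g (n + d') * g' n)"
proof (transfer, rule ext)
  fix d d' and g g' :: "int \<Rightarrow> 'k::field" and x
  show "shift_by d g (shift_by d' g' x) = shift_by (d' + d) (\<lambda>n. g (n + d') * g' n) x"
    by (induction x rule: poly_mapping_add_induct) (simp_all add: shift_by_add add_ac mult_ac)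
qed

lemma shift_weighted_diff:
  "shift_weighted d g - shift_weighted d g' = shift_weighted d (\<lambda>n. g n - g' n)"
proof (transfer, rule ext)
  fix d and g g' :: "int \<Rightarrow> 'k::field" and x
  show "shift_by d g x - shift_by d g' x = shift_by d (\<lambda>n. g n - g' n) x"
    by (induction x rule: poly_mapping_add_induct)
       (simp_all add: shift_by_add single_diff[symmetric] algebra_simps)
qed

lemma shift_weighted_one: "shift_weighted 0 (\<lambda>_. 1) = 1"
proof (transfer, rule ext)
  fix x :: "int \<Rightarrow>\<^sub>0 'k::field"
  show "shift_by 0 (\<lambda>_. 1) x = x"
    by (induction x rule: poly_mapping_add_induct) (simp_all add: shift_by_add)
qed

fun shift_gen :: "jordan_gen \<Rightarrow> 'k::field shift_op" where
  "shift_gen GenU = shift_weighted 1 of_int"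
| "shift_gen GenV = shift_weighted 1 (\<lambda>_. 1)"

lift_definition jordan_rep :: "'k::field jordan \<Rightarrow> 'k shift_op" is "free_lift shift_const shift_gen"
proof -
  interpret algebra_struct "shift_const :: 'k \<Rightarrow> 'k shift_op" by (rule algebra_struct_shift_const)
  fix p q :: "('k, jordan_gen) free_algebra"
  assume "p - q \<in> two_sided_ideal hull jordan_relations"
  then show "free_lift shift_const shift_gen p = free_lift shift_const shift_gen q"
    by (rule free_lift_cong[rotated])
       (simp add: jordan_relations_def free_lift_diff free_lift_mult power2_eq_square
          shift_weighted_mult shift_weighted_diff)
qed

lemma jordan_rep_add: "jordan_rep (x + y) = jordan_rep x + jordan_rep y"
  by transfer (rule algebra_struct.free_lift_add[OF algebra_struct_shift_const])

lemma jordan_rep_mult: "jordan_rep (x * y) = jordan_rep x * jordan_rep y"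
  by transfer (rule algebra_struct.free_lift_mult[OF algebra_struct_shift_const])

lemma jordan_rep_const: "jordan_rep (jordan_const c) = shift_const c"
  by (simp add: jordan_const.abs_eq jordan_rep.abs_eq
      algebra_struct.free_lift_const[OF algebra_struct_shift_const])

lemma jordan_rep_v: "jordan_rep jordan_v = shift_weighted 1 (\<lambda>_. 1)"
  by (simp add: jordan_v.abs_eq jordan_rep.abs_eq
      algebra_struct.free_lift_gen[OF algebra_struct_shift_const])

lemmas jordan_rep_simps = jordan_rep_add jordan_rep_mult jordan_rep_const jordan_rep_v

fun shift_loc_gen :: "'k::field jordan option \<Rightarrow> 'k shift_op" where
  "shift_loc_gen (Some r) = jordan_rep r"
| "shift_loc_gen None = shift_weighted (- 1) (\<lambda>_. 1)"

lemma localization_relations_rep: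
  assumes "p \<in> localization_relations jordan_const jordan_v"
  shows "free_lift shift_const shift_loc_gen p = 0"
proof -
  interpret algebra_struct "shift_const :: 'a \<Rightarrow> 'a shift_op" by (rule algebra_struct_shift_const)
  show ?thesis
    using assms
    by (rule localization_relations_cases)
       (simp_all add: free_lift_diff free_lift_mult free_lift_add
        jordan_rep_simps shift_weighted_mult shift_weighted_one)
qed

instantiation jordan_loc :: (field) ring_1
begin

lift_definition zero_jordan_loc :: "'a jordan_loc" is 0 .
lift_definition one_jordan_loc :: "'a jordan_loc" is 1 .
lift_definition plus_jordan_loc :: "'a jordan_loc \<Rightarrow> 'a jordan_loc \<Rightarrow> 'a jordan_loc" is "(+)"
  by (rule ideal_cong_add[OF two_sided_ideal_hull])
lift_definition uminus_jordan_loc :: "'a jordan_loc \<Rightarrow> 'a jordan_loc" is uminus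
  by (rule ideal_cong_uminus[OF two_sided_ideal_hull])
lift_definition minus_jordan_loc :: "'a jordan_loc \<Rightarrow> 'a jordan_loc \<Rightarrow> 'a jordan_loc" is "(-)"
  by (rule ideal_cong_minus[OF two_sided_ideal_hull])
lift_definition times_jordan_loc :: "'a jordan_loc \<Rightarrow> 'a jordan_loc \<Rightarrow> 'a jordan_loc" is "(*)"
  by (rule ideal_cong_mult[OF two_sided_ideal_hull])

instance
proof
  show "(0::'a jordan_loc) \<noteq> 1"
  proof (transfer, rule notI)
    interpret algebra_struct "shift_const :: 'a \<Rightarrow> 'a shift_op" by (rule algebra_struct_shift_const)
    assume "(0::('a, 'a jordan option) free_algebra) - 1
      \<in> two_sided_ideal hull (localization_relations jordan_const jordan_v)"
    then have "free_lift shift_const shift_loc_gen (0::('a, 'a jordan option) free_algebra)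
        = free_lift shift_const shift_loc_gen (1::('a, 'a jordan option) free_algebra)"
      by (rule free_lift_cong[rotated]) (rule localization_relations_rep)
    then show False by simp
  qed
qed (transfer, simp add: algebra_simps ideal_0[OF two_sided_ideal_hull])+

end

lift_definition jl_const :: "'k::field \<Rightarrow> 'k jordan_loc" is fa_const .

definition jl_emb :: "'k::field jordan \<Rightarrow> 'k jordan_loc" where
  "jl_emb r = abs_jordan_loc (fa_gen (Some r))"

lift_definition jl_vinv :: "'k::field jordan_loc" is "fa_gen None" .

abbreviation jl_u :: "'k::field jordan_loc" where "jl_u \<equiv> jl_emb jordan_u"

abbreviation jl_v :: "'k::field jordan_loc" where "jl_v \<equiv> jl_emb jordan_v"

definition jl_vpow :: "int \<Rightarrow> 'k::field jordan_loc" where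
  "jl_vpow n = (if n \<ge> 0 then jl_v ^ nat n else jl_vinv ^ nat (- n))"

lemma algebra_struct_jl_const: "algebra_struct (jl_const :: 'k::field \<Rightarrow> 'k jordan_loc)"
  by unfold_locales
     (transfer, rule fa_const_hull)+

lemma jl_v_vinv: "jl_v * jl_vinv = (1 :: 'k::field jordan_loc)"
  and jl_vinv_v: "jl_vinv * jl_v = (1 :: 'k::field jordan_loc)"
  unfolding jl_emb_def jl_vinv_def one_jordan_loc.abs_eq times_jordan_loc.abs_eq jordan_loc.abs_eq_iff
  by (rule hull_inc, simp add: localization_relations_def)+

lemma jl_emb_add: "jl_emb (x + y) = jl_emb x + jl_emb y"
  unfolding jl_emb_def plus_jordan_loc.abs_eq jordan_loc.abs_eq_iff
  by (rule hull_inc) (auto simp: localization_relations_def)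

lemma jl_emb_mult: "jl_emb (x * y) = jl_emb x * jl_emb y"
  unfolding jl_emb_def times_jordan_loc.abs_eq jordan_loc.abs_eq_iff
  by (rule hull_inc) (auto simp: localization_relations_def)

lemma jl_emb_const: "jl_emb (jordan_const c) = jl_const c"
  unfolding jl_emb_def jl_const.abs_eq jordan_loc.abs_eq_iff
  by (rule hull_inc) (auto simp: localization_relations_def)

lemma algebra_hom_jl_emb: "algebra_hom jordan_const jl_const (jl_emb :: 'k::field jordan \<Rightarrow> 'k jordan_loc)"
proof -
  have "jl_emb (jordan_const (1::'k)) = jl_const 1" by (rule jl_emb_const)
  then have "jl_emb (1 :: 'k jordan) = 1"
    by (simp only: algebra_struct.one[OF algebra_struct_jordan_const]
        algebra_struct.one[OF algebra_struct_jl_const])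
  then show ?thesis
    by (simp add: algebra_hom_def jl_emb_add jl_emb_mult jl_emb_const)
qed

lemma jl_relation: "(jl_u :: 'k::field jordan_loc) * jl_v = jl_v * jl_u + jl_v * jl_v"
proof -
  have "(jordan_u :: 'k jordan) * jordan_v = jordan_v * jordan_u + jordan_v * jordan_v"
    using jordan_relation[where 'k = 'k] by (simp add: power2_eq_square algebra_simps)
  then show ?thesis by (simp only: jl_emb_add[symmetric] jl_emb_mult[symmetric])
qed

lemma jl_vpow_0 [simp]: "jl_vpow 0 = 1"
  by (simp add: jl_vpow_def)

lemma jl_vpow_Suc: "(jl_vpow (n + 1) :: 'k::field jordan_loc) = jl_vpow n * jl_v"
proof (cases "n \<ge> 0")
  case True
  then show ?thesis
    by (simp add: jl_vpow_def nat_add_distrib power_commutes)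
next
  case False
  then obtain m where m: "n = - 1 - int m"
    by (intro that[of "nat (- n - 1)"]) simp
  then have "nat (- n) = Suc m" by simp
  then have "(jl_vpow n :: 'k jordan_loc) * jl_v = jl_vinv ^ m * (jl_vinv * jl_v)"
    using False by (simp add: jl_vpow_def power_Suc2 mult.assoc del: power_Suc)
  also have "\<dots> = jl_vpow (n + 1)"
    using m by (cases m) (auto simp: jl_vpow_def jl_vinv_v nat_add_distrib)
  finally show ?thesis by simp
qed

lemma jl_vpow_diff_1: "(jl_vpow (n - 1) :: 'k::field jordan_loc) = jl_vpow n * jl_vinv"
  using jl_vpow_Suc[of "n - 1", where 'k = 'k] by (simp add: mult.assoc jl_v_vinv)

lemma jl_vpow_add: "jl_vpow n * jl_vpow m = (jl_vpow (n + m) :: 'k::field jordan_loc)"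
proof (induction m rule: int_induct[where k = 0])
  case (step1 m)
  then show ?case
    by (simp add: jl_vpow_Suc mult.assoc[symmetric] flip: add.assoc)
next
  case (step2 m)
  then show ?case
    by (simp add: jl_vpow_diff_1 mult.assoc[symmetric] add_diff_eq)
qed simp

lemma jl_vpow_1: "jl_vpow 1 = (jl_v :: 'k::field jordan_loc)"
  using jl_vpow_Suc[of 0, where 'k = 'k] by simp

lemma jl_v_vpow: "jl_v * jl_vpow n = (jl_vpow (n + 1) :: 'k::field jordan_loc)"
  using jl_vpow_add[of 1 n, where 'k = 'k] by (simp add: jl_vpow_1 add.commute)

lemma jl_vpow_u: "(jl_vpow n :: 'k::field jordan_loc) * jl_u = jl_u * jl_vpow n - of_int n * jl_vpow (n + 1)"
proof (induction n rule: int_induct[where k = 0])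
  case (step1 n)
  have "(jl_vpow (n + 1) :: 'k jordan_loc) * jl_u = jl_vpow n * (jl_v * jl_u)"
    by (simp add: jl_vpow_Suc mult.assoc)
  also have "\<dots> = jl_vpow n * jl_u * jl_v - jl_vpow n * jl_v * jl_v"
    using jl_relation[where 'k = 'k] by (simp add: algebra_simps)
  also have "\<dots> = jl_u * jl_vpow (n + 1) - of_int (n + 1) * jl_vpow (n + 1 + 1)"
    unfolding step1(2) jl_vpow_Suc by (simp add: algebra_simps)
  finally show ?case .
next
  case (step2 n)
  have *: "jl_vinv * jl_u = jl_u * jl_vinv + (1 :: 'k jordan_loc)"
  proof -
    have "jl_vinv * jl_u = jl_vinv * (jl_u * jl_v) * (jl_vinv :: 'k jordan_loc)"
      by (simp add: mult.assoc jl_v_vinv)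
    also have "\<dots> = (jl_vinv * jl_v) * jl_u * jl_vinv + (jl_vinv * jl_v) * (jl_v * jl_vinv)"
      by (simp add: jl_relation algebra_simps)
    finally show ?thesis by (simp add: jl_v_vinv jl_vinv_v)
  qed
  have "(jl_vpow (n - 1) :: 'k jordan_loc) * jl_u = jl_vpow n * (jl_vinv * jl_u)"
    by (simp add: jl_vpow_diff_1 mult.assoc)
  also have "\<dots> = jl_vpow n * jl_u * jl_vinv + jl_vpow n"
    by (simp add: * algebra_simps)
  also have "\<dots> = jl_u * jl_vpow (n - 1) - of_int (n - 1) * jl_vpow (n - 1 + 1)"
    unfolding step2(2) jl_vpow_diff_1 jl_vpow_Suc
    by (simp add: algebra_simps jl_v_vinv jl_vinv_v)
  finally show ?case .
qed simp


section \<open>The homomorphisms from the enveloping algebra to the localized Jordan plane\<close>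

definition jl_E :: "'k::field \<Rightarrow> int \<Rightarrow> 'k jordan_loc" where
  "jl_E a n = (jl_u - jl_const (of_int (n - 1) * a) * jl_v) * jl_vpow (n - 1)"

lemma jl_E_mult:
  "jl_E a n * jl_E a m = jl_u * jl_u * jl_vpow (n + m - 2)
     - jl_const (of_int (n - 1) + of_int (n + m - 2) * a) * (jl_u * jl_vpow (n + m - 1))
     + jl_const (of_int (n * (n - 1)) * a + of_int ((n - 1) * (m - 1)) * (a * a)) * jl_vpow (n + m)"
proof -
  interpret algebra_struct "jl_const :: 'a \<Rightarrow> 'a jordan_loc" by (rule algebra_struct_jl_const)
  define c where "c k = (jl_const (of_int (k - 1) * a) :: 'a jordan_loc)" for k
  have E: "jl_E a k = jl_u * jl_vpow (k - 1) - c k * jl_vpow k" for k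
    by (simp add: jl_E_def c_def left_diff_distrib mult.assoc jl_v_vpow)
  have cu: "jl_u * (c k * y) = c k * (jl_u * y)" for y k
    by (simp add: c_def left_central)
  have cP: "jl_vpow l * (c k * y) = c k * (jl_vpow l * y)" for y k l
    by (simp add: c_def left_central)
  have P: "jl_vpow k * (jl_vpow l * x) = jl_vpow (k + l) * x" for k l and x :: "'a jordan_loc"
    by (simp add: jl_vpow_add mult.assoc[symmetric])
  have U: "jl_vpow k * (jl_u * x) = jl_u * (jl_vpow k * x) - of_int k * (jl_vpow (k + 1) * x)"
    for k and x :: "'a jordan_loc"
    by (simp only: mult.assoc[of "jl_vpow k" jl_u x, symmetric] jl_vpow_u left_diff_distrib)
       (simp only: mult.assoc)
  have I: "jl_u * (of_int k * y) = of_int k * (jl_u * y)" for y :: "'a jordan_loc" and k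
    using left_central[of jl_u "of_int k" y] by (simp add: of_int)
  have *: "jl_E a n * jl_E a m =
      jl_u * (jl_u * jl_vpow (n + m - 2)) - of_int (n - 1) * (jl_u * jl_vpow (n + m - 1))
      - c m * (jl_u * jl_vpow (n + m - 1)) - c n * (jl_u * jl_vpow (n + m - 1))
      + c n * (of_int n * jl_vpow (n + m)) + c n * (c m * jl_vpow (n + m))"
    unfolding E
    by (simp add: left_diff_distrib right_diff_distrib mult.assoc cu cP P U I jl_vpow_add
        diff_add_eq add_diff_eq del: of_int_diff)
  show ?thesis
    unfolding * c_def of_int[symmetric]
    by (simp add: mult.assoc[symmetric] mult[symmetric]) (simp add: add diff mult of_int[of 2, simplified] mult_2 algebra_simps)
qed

lemma jl_E_commutator:
  "jl_E a n * jl_E a m - jl_E a m * jl_E a n = jl_const (of_int (m - n)) * jl_E a (n + m)"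
proof -
  interpret algebra_struct "jl_const :: 'a \<Rightarrow> 'a jordan_loc" by (rule algebra_struct_jl_const)
  define A where "A = (of_int (m - 1) + of_int (m + n - 2) * a) - (of_int (n - 1) + of_int (n + m - 2) * a)"
  define B where "B = (of_int (n * (n - 1)) * a + of_int ((n - 1) * (m - 1)) * (a * a))
      - (of_int (m * (m - 1)) * a + of_int ((m - 1) * (n - 1)) * (a * a))"
  have "jl_E a n * jl_E a m - jl_E a m * jl_E a n
      = jl_const A * (jl_u * jl_vpow (n + m - 1)) + jl_const B * jl_vpow (n + m)"
    unfolding jl_E_mult A_def B_def
    by (simp only: diff left_diff_distrib add.commute[of m n]) (simp add: algebra_simps)
  also have "A = of_int (m - n)"
    by (simp add: A_def algebra_simps)
  also have "B = - (of_int (m - n) * (of_int (n + m - 1) * a))"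
    by (simp add: B_def algebra_simps)
  finally show ?thesis
    by (simp add: jl_E_def left_diff_distrib right_diff_distrib mult.assoc jl_v_vpow uminus mult
        del: of_int_diff of_int_add)
qed

abbreviation jl_witt :: "'k::field \<Rightarrow> 'k witt \<Rightarrow> 'k jordan_loc" where
  "jl_witt a \<equiv> linear_ext jl_const (jl_E a)"

lemma jl_witt_bracket:
  "jl_witt a x * jl_witt a y - jl_witt a y * jl_witt a x = jl_witt a (witt_bracket x y)"
proof -
  interpret algebra_struct "jl_const :: 'a \<Rightarrow> 'a jordan_loc" by (rule algebra_struct_jl_const)
  show ?thesis
  proof (induction x rule: poly_mapping_add_induct)
    case (single n c)
    show ?case
    proof (induction y rule: poly_mapping_add_induct)
      case (single m d)
      have "jl_const c * jl_E a n * (jl_const d * jl_E a m) - jl_const d * jl_E a m * (jl_const c * jl_E a n)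
          = jl_const (c * d) * (jl_E a n * jl_E a m - jl_E a m * jl_E a n)"
        by (simp only: mult mult.assoc right_diff_distrib left_central[of "jl_E a n" d "jl_E a m"]
            left_central[of "jl_E a m" c "jl_E a n"]
            left_central[of "jl_const d" c "jl_E a m * jl_E a n"])
      also have "\<dots> = jl_const (c * d * of_int (m - n)) * jl_E a (n + m)"
        by (simp only: jl_E_commutator mult mult.assoc)
      also have "c * d * of_int (m - n) = of_int (m - n) * c * d"
        by (simp only: mult_ac)
      finally show ?case
        by (simp only: linear_ext_single witt_bracket_single)
    next
      case (add y z)
      then show ?case
        by (simp add: linear_ext_add witt_bracket_add_right algebra_simps)
    qed
  next
    case (add x z)
    then show ?case
      by (simp add: linear_ext_add witt_bracket_add_left algebra_simps)
  qed
qed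

text \<open>By \<open>algebra_hom_lambda_hat\<close> and \<open>lambda_hat_e\<close> below, \<open>lambda_hat a\<close> is the algebra
  homomorphism with \<open>e\<^sub>n \<mapsto> (u - (n - 1) a v) v\<^bsup>n - 1\<^esup>\<close> for all \<open>n \<in> \<int>\<close>.\<close>

lift_definition lambda_hat :: "'k::field \<Rightarrow> 'k U_witt \<Rightarrow> 'k jordan_loc" is
  "\<lambda>a. free_lift jl_const (jl_witt a)"
proof -
  interpret algebra_struct "jl_const :: 'k \<Rightarrow> 'k jordan_loc" by (rule algebra_struct_jl_const)
  fix a :: 'k and p q :: "('k, 'k witt) free_algebra"
  assume "p - q \<in> two_sided_ideal hull (enveloping_relations witt_scale witt_bracket)"
  then show "free_lift jl_const (jl_witt a) p = free_lift jl_const (jl_witt a) q"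
    by (rule free_lift_cong[rotated])
       (erule enveloping_relations_cases, simp_all add: free_lift_diff free_lift_mult free_lift_add
          linear_ext_add linear_ext_scale witt_scale_def jl_witt_bracket)
qed

lemma algebra_hom_lambda_hat:
  "algebra_hom ue_const jl_const (lambda_hat a :: 'k::field U_witt \<Rightarrow> 'k jordan_loc)"
proof -
  interpret algebra_struct "jl_const :: 'k \<Rightarrow> 'k jordan_loc" by (rule algebra_struct_jl_const)
  have "lambda_hat a (x + y) = lambda_hat a x + lambda_hat a y" for x y
    by (induction x rule: U_witt.abs_induct, induction y rule: U_witt.abs_induct)
       (simp only: plus_U_witt.abs_eq lambda_hat.abs_eq free_lift_add)
  moreover have "lambda_hat a (x * y) = lambda_hat a x * lambda_hat a y" for x y
    by (induction x rule: U_witt.abs_induct, induction y rule: U_witt.abs_induct)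
       (simp only: times_U_witt.abs_eq lambda_hat.abs_eq free_lift_mult)
  moreover have "lambda_hat a 1 = 1"
    by (simp only: one_U_witt.abs_eq lambda_hat.abs_eq free_lift_1)
  moreover have "lambda_hat a (ue_const c) = jl_const c" for c
    by (simp only: ue_const.abs_eq lambda_hat.abs_eq free_lift_const)
  ultimately show ?thesis
    unfolding algebra_hom_def by blast
qed

lemma lambda_hat_e:
  "lambda_hat a (ue_emb (witt_e n))
     = (jl_u - jl_const (of_int (n - 1) * a) * jl_v) * jl_vpow (n - 1)"
proof -
  interpret algebra_struct "jl_const :: 'a \<Rightarrow> 'a jordan_loc" by (rule algebra_struct_jl_const)
  show ?thesis
    by (simp add: ue_emb_def lambda_hat.abs_eq witt_e_def one jl_E_def)
qed

definition ring_kernel :: "('a::ring_1 \<Rightarrow> 'b::ring_1) \<Rightarrow> 'a set" where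
  "ring_kernel f = {x. f x = 0}"

end

theory Submission
  imports Defs "HOL-Computational_Algebra.Polynomial"
begin

text \<open>Since \<open>\<lambda>\<^sub>0(e\<^sub>n) = u v\<^bsup>n - 1\<^esup>\<close> and \<open>\<lambda>\<^sub>1(e\<^sub>n) = v\<^bsup>n - 1\<^esup> u\<close>, one has
  \<open>u \<lambda>\<^sub>1(x) = \<lambda>\<^sub>0(x) u\<close> for all \<open>x\<close>, and \<open>u\<close> is regular; so the kernels agree.

  Write \<open>K\<close> for this kernel. The \<open>\<lambda>\<^sub>a\<close> form a polynomial family of representations by weighted
  shifts on the space with basis \<open>(t\<^sub>i)\<close>. At \<open>a = 0\<close> and at \<open>a = 1\<close> let \<open>\<delta>\<close> be the derivative of this
  family in the parameter. By the product rule, \<open>\<delta>(r x) = \<lambda>\<^sub>a(r) \<delta>(x)\<close> and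
  \<open>\<delta>(x r) = \<delta>(x) \<lambda>\<^sub>a(r)\<close> for \<open>x \<in> K\<close>.
  At \<open>a = 0\<close> each \<open>\<lambda>\<^sub>0(r)\<close> multiplies the row of index 1 by a scalar, so all \<open>\<delta>(x)\<close> with \<open>x\<close> in a
  finitely generated left ideal contained in \<open>K\<close> have their row 1 supported in a common finite set.
  At \<open>a = 1\<close> the vector \<open>t\<^sub>0\<close> is a common eigenvector, which bounds column 0 for right
  ideals. But \<open>e\<^sub>N\<^sub>-\<^sub>1 e\<^sub>1 + e\<^sub>N\<^sub>+\<^sub>1 e\<^sub>-\<^sub>1 - 2 e\<^sub>N e\<^sub>0 \<in> K\<close> has \<open>\<delta>\<close> equal to a nonzero multiple of
  the shift \<open>t\<^sub>i \<mapsto> t\<^sub>i\<^sub>+\<^sub>N\<close>, for every \<open>N\<close>.\<close>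


section \<open>Induction over generators\<close>

lemma free_algebra_induct [case_names const gen add mult]:
  fixes p :: "('k::field, 'x) free_algebra"
  assumes const: "\<And>c. P (fa_const c)" and gen: "\<And>x. P (fa_gen x)"
    and add: "\<And>p q. P p \<Longrightarrow> P q \<Longrightarrow> P (p + q)" and mult: "\<And>p q. P p \<Longrightarrow> P q \<Longrightarrow> P (p * q)"
  shows "P p"
proof (induction p rule: poly_mapping_add_induct)
  case (single w c)
  have "P (Poly_Mapping.single (FM xs) c)" for xs
  proof (induction xs)
    case Nil
    show ?case using const[of c] by (simp add: fa_const_def zero_free_monoid_def)
  next
    case (Cons x xs)
    have "Poly_Mapping.single (FM (x # xs)) c = fa_gen x * Poly_Mapping.single (FM xs) c"
      by (simp add: fa_gen_def mult_single plus_free_monoid_def)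
    then show ?case using mult[OF gen Cons] by simp
  qed
  then show ?case by (cases w) simp
qed (rule add)

lemma ue_emb_add: "ue_emb (x + y) = ue_emb x + ue_emb y"
  unfolding ue_emb_def plus_U_witt.abs_eq U_witt.abs_eq_iff
  by (rule hull_inc) (auto simp: enveloping_relations_def)

lemma ue_emb_scale: "ue_emb (witt_scale c x) = ue_const c * ue_emb x"
  unfolding ue_emb_def ue_const.abs_eq times_U_witt.abs_eq U_witt.abs_eq_iff
  by (rule hull_inc) (auto simp: enveloping_relations_def)

text \<open>\<open>ue_emb\<close> is linear, so the \<open>e_n\<close> and the constants suffice as
  generators.\<close>

lemma U_witt_induct [case_names const gen add mult]:
  fixes x :: "'k::field U_witt"
  assumes const: "\<And>c. P (ue_const c)" and gen: "\<And>n. P (ue_emb (witt_e n))"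
    and add: "\<And>x y. P x \<Longrightarrow> P y \<Longrightarrow> P (x + y)" and mult: "\<And>x y. P x \<Longrightarrow> P y \<Longrightarrow> P (x * y)"
  shows "P x"
proof (induction x rule: U_witt.abs_induct)
  case (1 p)
  show ?case
  proof (induction p rule: free_algebra_induct)
    case (const c)
    show ?case using assms(1)[of c] by (simp add: ue_const.abs_eq)
  next
    case (gen w)
    have "P (ue_emb w)"
    proof (induction w rule: poly_mapping_add_induct)
      case (single n c)
      have "Poly_Mapping.single n c = witt_scale c (witt_e n)"
        by (simp add: witt_e_def)
      then show ?case by (simp add: ue_emb_scale mult const assms(2))
    qed (simp add: ue_emb_add add)
    then show ?case by (simp add: ue_emb_def)
  qed (simp_all only: plus_U_witt.abs_eq[symmetric] times_U_witt.abs_eq[symmetric] assms)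
qed

lemma jordan_induct [case_names const u v add mult]:
  fixes x :: "'k::field jordan"
  assumes "\<And>c. P (jordan_const c)" and "P jordan_u" and "P jordan_v"
    and "\<And>x y. P x \<Longrightarrow> P y \<Longrightarrow> P (x + y)" and "\<And>x y. P x \<Longrightarrow> P y \<Longrightarrow> P (x * y)"
  shows "P x"
proof (induction x rule: jordan.abs_induct)
  case (1 p)
  show ?case
  proof (induction p rule: free_algebra_induct)
    case (gen g)
    show ?case using assms(2,3) by (cases g) (simp_all add: jordan_u.abs_eq jordan_v.abs_eq)
  qed (simp_all only: jordan_const.abs_eq[symmetric] plus_jordan.abs_eq[symmetric]
      times_jordan.abs_eq[symmetric] assms)
qed

lemma jordan_loc_induct [case_names const u v vinv add mult]:
  fixes x :: "'k::field jordan_loc"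
  assumes "\<And>c. P (jl_const c)" and "P jl_u" and "P jl_v" and "P jl_vinv"
    and "\<And>x y. P x \<Longrightarrow> P y \<Longrightarrow> P (x + y)" and "\<And>x y. P x \<Longrightarrow> P y \<Longrightarrow> P (x * y)"
  shows "P x"
proof (induction x rule: jordan_loc.abs_induct)
  case (1 p)
  show ?case
  proof (induction p rule: free_algebra_induct)
    case (gen g)
    have "P (jl_emb r)" for r
      by (induction r rule: jordan_induct) (simp_all add: jl_emb_const jl_emb_add jl_emb_mult assms)
    then show ?case
      using assms(4) by (cases g) (simp_all add: jl_vinv.abs_eq jl_emb_def)
  qed (simp_all only: jl_const.abs_eq[symmetric] plus_jordan_loc.abs_eq[symmetric]
      times_jordan_loc.abs_eq[symmetric] assms)
qed


section \<open>The localized Jordan plane acts faithfully by weighted shifts\<close>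

lift_definition jl_rep :: "'k::field jordan_loc \<Rightarrow> 'k shift_op"
  is "free_lift shift_const shift_loc_gen"
proof -
  interpret algebra_struct "shift_const :: 'k \<Rightarrow> 'k shift_op" by (rule algebra_struct_shift_const)
  fix p q :: "('k, 'k jordan option) free_algebra"
  assume "p - q \<in> two_sided_ideal hull (localization_relations jordan_const jordan_v)"
  then show "free_lift shift_const shift_loc_gen p = free_lift shift_const shift_loc_gen q"
    by (rule free_lift_cong[rotated]) (rule localization_relations_rep)
qed

lemma jl_rep_add: "jl_rep (x + y) = jl_rep x + jl_rep y"
  by transfer (rule algebra_struct.free_lift_add[OF algebra_struct_shift_const])

lemma jl_rep_mult: "jl_rep (x * y) = jl_rep x * jl_rep y"
  by transfer (rule algebra_struct.free_lift_mult[OF algebra_struct_shift_const])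

lemma jl_rep_const: "jl_rep (jl_const c) = shift_const c"
  by (simp add: jl_const.abs_eq jl_rep.abs_eq
      algebra_struct.free_lift_const[OF algebra_struct_shift_const])

lemma jl_rep_emb: "jl_rep (jl_emb r) = jordan_rep r"
  by (simp add: jl_emb_def jl_rep.abs_eq
      algebra_struct.free_lift_gen[OF algebra_struct_shift_const])

lemma jl_rep_u: "jl_rep jl_u = shift_weighted 1 of_int"
  by (simp add: jl_rep_emb jordan_u.abs_eq jordan_rep.abs_eq
      algebra_struct.free_lift_gen[OF algebra_struct_shift_const])

lemma jl_rep_v: "jl_rep jl_v = shift_weighted 1 (\<lambda>_. 1)"
  by (simp add: jl_rep_emb jordan_rep_v)

lemma jl_rep_vinv: "jl_rep jl_vinv = shift_weighted (- 1) (\<lambda>_. 1)"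
  by (simp add: jl_vinv.abs_eq jl_rep.abs_eq
      algebra_struct.free_lift_gen[OF algebra_struct_shift_const])

lemma jl_rep_1: "jl_rep 1 = 1"
  using jl_rep_const[of "1 :: 'a"]
  by (simp add: algebra_struct.one[OF algebra_struct_jl_const]
      algebra_struct.one[OF algebra_struct_shift_const])

lemma jl_rep_vpow: "jl_rep (jl_vpow n) = shift_weighted n (\<lambda>_. 1)"
proof (induction n rule: int_induct[where k = 0])
  case base
  show ?case by (simp add: jl_rep_1 shift_weighted_one)
qed (simp_all add: jl_vpow_Suc jl_vpow_diff_1 jl_rep_mult jl_rep_v jl_rep_vinv shift_weighted_mult add.commute)

text \<open>The operator of \<open>jl_vinv * jl_u\<close> is diagonal, so each of these products
  acts as a single weighted shift with a monomial weight.\<close>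

definition jl_basis :: "int \<times> nat \<Rightarrow> 'k::field jordan_loc" where
  "jl_basis = (\<lambda>(j, i). jl_vpow j * (jl_vinv * jl_u) ^ i)"

lemma jl_rep_basis: "jl_rep (jl_basis (j, i)) = shift_weighted j (\<lambda>n. of_int n ^ i)"
proof -
  have "jl_rep ((jl_vinv * jl_u) ^ i) = (shift_weighted 0 (\<lambda>n. of_int n ^ i) :: 'a shift_op)"
  proof (induction i)
    case 0
    show ?case by (simp add: jl_rep_1 shift_weighted_one)
  next
    case (Suc i)
    then show ?case
      by (simp add: jl_rep_mult jl_rep_u jl_rep_vinv shift_weighted_mult)
  qed
  then show ?thesis
    by (simp add: jl_basis_def jl_rep_mult jl_rep_vpow shift_weighted_mult)
qed

text \<open>The span contains 1 and is stable under left multiplication by every generator, hence by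
  every element.\<close>

lemma jl_basis_span: "x \<in> range (linear_ext jl_const jl_basis)"
  for x :: "'k::field jordan_loc"
proof -
  interpret algebra_struct "jl_const :: 'k \<Rightarrow> 'k jordan_loc" by (rule algebra_struct_jl_const)
  let ?M = "range (linear_ext jl_const jl_basis) :: 'k jordan_loc set"
  have closed_add: "a + b \<in> ?M" if "a \<in> ?M" "b \<in> ?M" for a b
    using that by (auto simp: linear_ext_add[symmetric])
  have closed_const: "jl_const c * a \<in> ?M" if "a \<in> ?M" for a c
    using that by (auto simp: linear_ext_scale[symmetric])
  have basis: "jl_basis n \<in> ?M" for n
    using linear_ext_single[of jl_basis n 1] by (metis mult_1 one rangeI)
  have closed_mult: "y * a \<in> ?M" if "\<And>n. y * jl_basis n \<in> ?M" "a \<in> ?M" for y a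
  proof -
    have "y * linear_ext jl_const jl_basis p \<in> ?M" for p
      by (induction p rule: poly_mapping_add_induct)
        (simp_all add: left_central closed_const that(1) linear_ext_add distrib_left closed_add)
    then show ?thesis using that(2) by auto
  qed
  have v_basis: "jl_v * jl_basis n = (jl_basis (fst n + 1, snd n) :: 'k jordan_loc)" for n
    by (simp add: jl_basis_def split_beta jl_v_vpow flip: mult.assoc)
  have vinv_basis: "jl_vinv * jl_basis n = (jl_basis (fst n - 1, snd n) :: 'k jordan_loc)" for n
    using jl_vpow_add[of "-1" "fst n", where 'k = 'k]
    by (simp add: jl_basis_def split_beta jl_vpow_def[of "- 1"] flip: mult.assoc)
  \<comment> \<open>Moving u past v^j costs j v^(j+1), and v^j u = v^(j+1) (v^-1 u).\<close>
  have u_basis: "jl_u * jl_basis n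
      = jl_basis (fst n + 1, Suc (snd n)) + jl_const (of_int (fst n)) * (jl_basis (fst n + 1, snd n) :: 'k jordan_loc)"
    for n :: "int \<times> nat"
  proof -
    have "jl_vpow (fst n) = jl_vpow (fst n + 1) * (jl_vinv :: 'k jordan_loc)"
      using jl_vpow_diff_1[of "fst n + 1", where 'k = 'k] by simp
    then have "jl_u * jl_vpow (fst n)
      = jl_vpow (fst n + 1) * (jl_vinv * jl_u) + of_int (fst n) * (jl_vpow (fst n + 1) :: 'k jordan_loc)"
      using jl_vpow_u[of "fst n", where 'k = 'k] by (simp add: mult.assoc)
    then show ?thesis
      by (simp add: jl_basis_def split_beta of_int distrib_right mult.assoc[symmetric])
  qed
  have "x * a \<in> ?M" if "a \<in> ?M" for a
    using that
  proof (induction x arbitrary: a rule: jordan_loc_induct)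
    case (add x y)
    then show ?case by (simp only: distrib_right closed_add)
  next
    case (mult x y)
    then show ?case by (simp only: mult.assoc)
  next
    case u
    then show ?case by (rule closed_mult[rotated]) (simp_all only: u_basis closed_add closed_const basis)
  next
    case v
    then show ?case by (rule closed_mult[rotated]) (simp_all only: v_basis basis)
  next
    case vinv
    then show ?case by (rule closed_mult[rotated]) (simp_all only: vinv_basis basis)
  qed (rule closed_const)
  from this[OF basis[of "(0, 0)"]] show ?thesis
    by (simp add: jl_basis_def)
qed

text \<open>\<open>v\<^sup>-\<^sup>1 u\<close> acts by \<open>t\<^sub>i \<mapsto> i t\<^sub>i\<close>, so the coefficient of \<open>v\<^sup>j\<close> acts as a polynomial in \<open>i\<close>, which vanishes
  once it has infinitely many roots.\<close>

definition column_poly :: "int \<Rightarrow> (int \<times> nat \<Rightarrow>\<^sub>0 'k::field) \<Rightarrow> 'k poly" where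
  "column_poly j p = (\<Sum>n\<in>Poly_Mapping.keys p. if fst n = j then monom (Poly_Mapping.lookup p n) (snd n) else 0)"

lemma coeff_column_poly: "coeff (column_poly j p) i = Poly_Mapping.lookup p (j, i)"
proof -
  have "coeff (column_poly j p) i
      = (\<Sum>n\<in>Poly_Mapping.keys p. if n = (j, i) then Poly_Mapping.lookup p n else 0)"
    unfolding column_poly_def coeff_sum by (intro sum.cong) auto
  then show ?thesis by (auto simp: in_keys_iff)
qed

lemma column_poly_add: "column_poly j (p + q) = column_poly j p + column_poly j q"
  by (rule poly_eqI) (simp add: coeff_column_poly lookup_add)

lemma column_poly_single: "column_poly j (Poly_Mapping.single n c) = (if fst n = j then monom c (snd n) else 0)"
  by (simp add: column_poly_def)

section \<open>Matrix entries of shift operators\<close>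

lemma Rep_shift_op_simps:
  "Rep_shift_op (f + g) x = Rep_shift_op f x + Rep_shift_op g x"
  "Rep_shift_op (f * g) x = Rep_shift_op f (Rep_shift_op g x)"
  "Rep_shift_op (shift_const c) x = witt_scale c x"
  "Rep_shift_op (shift_weighted d w) x = shift_by d w x"
  "Rep_shift_op 0 x = 0"
  "Rep_shift_op f (x + y) = Rep_shift_op f x + Rep_shift_op f y"
  "Rep_shift_op f (witt_scale c x) = witt_scale c (Rep_shift_op f x)"
  using Rep_shift_op[of f]
  by (simp_all add: plus_shift_op.rep_eq times_shift_op.rep_eq shift_const.rep_eq
      shift_weighted.rep_eq zero_shift_op.rep_eq)

text \<open>Row index first: the coefficient of t_j in the image of t_i. Columns are finitely
  supported, so the sum in \<open>entry_mult\<close> is finite.\<close>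

definition entry :: "'k::field shift_op \<Rightarrow> int \<Rightarrow> int \<Rightarrow> 'k" where
  "entry f j i = Poly_Mapping.lookup (Rep_shift_op f (witt_e i)) j"

lemma entry_add: "entry (f + g) j i = entry f j i + entry g j i"
  by (simp add: entry_def Rep_shift_op_simps lookup_add)

lemma entry_0: "entry 0 j i = 0"
  by (simp add: entry_def Rep_shift_op_simps)

lemma entry_shift_weighted: "entry (shift_weighted d w) j i = (if j = i + d then w i else 0)"
  by (simp add: entry_def Rep_shift_op_simps witt_e_def lookup_single when_def)

lemma lookup_Rep_shift_op:
  "Poly_Mapping.lookup (Rep_shift_op f x) j = (\<Sum>k\<in>Poly_Mapping.keys x. entry f j k * Poly_Mapping.lookup x k)"
proof (induction x rule: poly_mapping_add_induct)
  case (single n c)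
  have "Poly_Mapping.single n c = witt_scale c (witt_e n)"
    by (simp add: witt_e_def)
  then have "Poly_Mapping.lookup (Rep_shift_op f (Poly_Mapping.single n c)) j = entry f j n * c"
    by (simp only: Rep_shift_op_simps) (simp add: entry_def mult.commute)
  then show ?case by simp
next
  case (add x y)
  have "(\<Sum>k\<in>Poly_Mapping.keys (x + y). entry f j k * Poly_Mapping.lookup (x + y) k)
    = (\<Sum>k\<in>Poly_Mapping.keys x. entry f j k * Poly_Mapping.lookup x k)
    + (\<Sum>k\<in>Poly_Mapping.keys y. entry f j k * Poly_Mapping.lookup y k)"
    by (rule sum_keys_add[of "\<lambda>k c. entry f j k * c"]) (simp_all add: distrib_left)
  with add show ?case by (simp add: Rep_shift_op_simps lookup_add)
qed

lemma entry_mult: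
  "entry (f * g) j i = (\<Sum>k | entry g k i \<noteq> 0. entry f j k * entry g k i)"
proof -
  have "Poly_Mapping.keys (Rep_shift_op g (witt_e i)) = {k. entry g k i \<noteq> 0}"
    by (auto simp: entry_def in_keys_iff)
  then show ?thesis
    unfolding entry_def[of "f * g"] Rep_shift_op_simps
      lookup_Rep_shift_op[of f "Rep_shift_op g (witt_e i)"]
    by (simp only: entry_def[of g])
qed

lemma entry_jl_rep_linear_ext:
  "entry (jl_rep (linear_ext jl_const jl_basis p)) (i + j) i = poly (column_poly j p) (of_int i)"
proof (induction p rule: poly_mapping_add_induct)
  case (single n c)
  have "entry (shift_const c * shift_weighted (fst n) (\<lambda>k. of_int k ^ snd n)) (i + j) i
    = (if j = fst n then c * of_int i ^ snd n else 0)"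
    by (simp add: entry_def Rep_shift_op_simps witt_e_def lookup_single when_def)
  then show ?case
    using jl_rep_basis[of "fst n" "snd n", where 'a = 'a]
    by (auto simp: algebra_struct.linear_ext_single[OF algebra_struct_jl_const] jl_rep_mult
        jl_rep_const column_poly_single poly_monom)
qed (simp add: algebra_struct.linear_ext_add[OF algebra_struct_jl_const] jl_rep_add entry_add
    column_poly_add)

text \<open>Each diagonal is a polynomial in the column index. Ignoring one row and one column costs
  at most two of its values, and in characteristic 0 infinitely many roots remain.\<close>

lemma jordan_loc_eq_0I:
  fixes x :: "'k::field_char_0 jordan_loc"
  assumes "\<And>i j. i \<noteq> a \<Longrightarrow> j \<noteq> b \<Longrightarrow> entry (jl_rep x) j i = 0"
  shows "x = 0"
proof -
  from jl_basis_span[of x] obtain p where x: "x = linear_ext jl_const jl_basis p"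
    by blast
  have "column_poly j p = 0" for j
  proof (rule ccontr)
    assume "column_poly j p \<noteq> 0"
    then have "finite {z. poly (column_poly j p) z = 0}"
      by (rule poly_roots_finite)
    moreover have "of_int ` (- {a, b - j}) \<subseteq> {z. poly (column_poly j p) z = 0}"
      using assms by (auto simp: x entry_jl_rep_linear_ext[symmetric])
    ultimately have "finite (of_int ` (- {a, b - j}) :: 'k set)"
      by (rule finite_subset[rotated])
    then have "finite (- {a, b - j})"
      by (rule finite_imageD) (auto intro: inj_onI)
    then show False
      by (simp add: finite_compl infinite_UNIV_int)
  qed
  then have "p = 0"
    by (intro poly_mapping_eqI) (metis coeff_0 coeff_column_poly lookup_zero surj_pair)
  then show ?thesis
    by (simp add: x linear_ext_def)
qed

text \<open>Since u t_j = j t_(j+1), the product u x determines every row of x but row 0, and x u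
  determines every column but column 1.\<close>

lemma jl_u_regular:
  fixes x :: "'k::field_char_0 jordan_loc"
  shows jl_u_left_regular: "jl_u * x = 0 \<Longrightarrow> x = 0"
    and jl_u_right_regular: "x * jl_u = 0 \<Longrightarrow> x = 0"
proof -
  have 0: "jl_rep (0 :: 'k jordan_loc) = 0"
    using jl_rep_add[of "0 :: 'k jordan_loc" 0] by simp
  show "x = 0" if "jl_u * x = 0"
  proof (rule jordan_loc_eq_0I[where b = 0])
    fix i j :: int
    assume "j \<noteq> 0"
    have "0 = entry (jl_rep (jl_u * x)) (j + 1) i"
      by (simp add: that 0 entry_0)
    also have "\<dots> = (\<Sum>k | entry (jl_rep x) k i \<noteq> 0. if k = j then of_int j * entry (jl_rep x) j i else 0)"
      unfolding jl_rep_mult jl_rep_u entry_mult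
      by (intro sum.cong) (auto simp: entry_shift_weighted)
    also have "finite {k. entry (jl_rep x) k i \<noteq> 0}"
      by (simp add: entry_def flip: in_keys_iff)
    then have "(\<Sum>k | entry (jl_rep x) k i \<noteq> 0. if k = j then of_int j * entry (jl_rep x) j i else 0)
        = of_int j * entry (jl_rep x) j i"
      by simp
    finally show "entry (jl_rep x) j i = 0"
      using \<open>j \<noteq> 0\<close> by simp
  qed
  show "x = 0" if "x * jl_u = 0"
  proof (rule jordan_loc_eq_0I[where a = 1])
    fix i j :: int
    assume "i \<noteq> 1"
    have "0 = entry (jl_rep (x * jl_u)) j (i - 1)"
      by (simp add: that 0 entry_0)
    also have "\<dots> = of_int (i - 1) * entry (jl_rep x) j i"
    proof -
      have "shift_by 1 of_int (witt_e (i - 1)) = (witt_scale (of_int (i - 1)) (witt_e i) :: 'k witt)"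
        by (simp add: witt_e_def)
      then show ?thesis
        by (simp add: entry_def jl_rep_mult jl_rep_u Rep_shift_op_simps)
    qed
    finally have "(of_int (i - 1) :: 'k) = 0 \<or> entry (jl_rep x) j i = 0"
      by (metis mult_eq_0_iff)
    with \<open>i \<noteq> 1\<close> show "entry (jl_rep x) j i = 0"
      by (simp only: of_int_eq_0_iff) simp
  qed
qed


section \<open>The universal property of the enveloping algebra\<close>

text \<open>A representative is chosen because the value is independent of it only when
  \<open>g\<close> satisfies the Witt relations; \<open>U_witt_lift_abs\<close> proves this under
  that assumption.\<close>

definition U_witt_lift :: "('k::field \<Rightarrow> 'a::ring_1) \<Rightarrow> (int \<Rightarrow> 'a) \<Rightarrow> 'k U_witt \<Rightarrow> 'a" where
  "U_witt_lift \<kappa> g x = free_lift \<kappa> (linear_ext \<kappa> g) (rep_U_witt x)"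

context algebra_struct
begin

context
  fixes g :: "int \<Rightarrow> 'a"
  assumes comm: "\<And>n m. g n * g m - g m * g n = \<kappa> (of_int (m - n)) * g (n + m)"
begin

lemma linear_ext_witt_bracket:
  "linear_ext \<kappa> g x * linear_ext \<kappa> g y - linear_ext \<kappa> g y * linear_ext \<kappa> g x
    = linear_ext \<kappa> g (witt_bracket x y)"
proof (induction x rule: poly_mapping_add_induct)
  case (single n c)
  show ?case
  proof (induction y rule: poly_mapping_add_induct)
    case (single m d)
    have "\<kappa> c * g n * (\<kappa> d * g m) - \<kappa> d * g m * (\<kappa> c * g n)
        = \<kappa> (c * d) * (g n * g m - g m * g n)"
      by (simp only: mult mult.assoc right_diff_distrib left_central[of "g n" d "g m"]
          left_central[of "g m" c "g n"] left_central[of "\<kappa> d" c "g m * g n"])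
    also have "\<dots> = \<kappa> (c * d * of_int (m - n)) * g (n + m)"
      by (simp only: comm mult mult.assoc)
    also have "c * d * of_int (m - n) = of_int (m - n) * c * d"
      by (simp only: mult_ac)
    finally show ?case
      by (simp only: linear_ext_single witt_bracket_single)
  next
    case (add y z)
    then show ?case
      by (simp add: linear_ext_add witt_bracket_add_right algebra_simps)
  qed
next
  case (add x z)
  then show ?case
    by (simp add: linear_ext_add witt_bracket_add_left algebra_simps)
qed

lemma U_witt_lift_abs: "U_witt_lift \<kappa> g (abs_U_witt p) = free_lift \<kappa> (linear_ext \<kappa> g) p"
proof -
  have "abs_U_witt (rep_U_witt (abs_U_witt p)) = abs_U_witt p"
    by (rule Quotient_abs_rep[OF Quotient_U_witt])
  then have "rep_U_witt (abs_U_witt p) - p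
      \<in> two_sided_ideal hull (enveloping_relations witt_scale witt_bracket)"
    by (simp only: U_witt.abs_eq_iff)
  then show ?thesis
    unfolding U_witt_lift_def
    by (rule free_lift_cong[rotated])
       (erule enveloping_relations_cases, simp_all add: free_lift_diff free_lift_mult free_lift_add
          linear_ext_add linear_ext_scale witt_scale_def linear_ext_witt_bracket)
qed

lemma U_witt_lift_e: "U_witt_lift \<kappa> g (ue_emb (witt_e n)) = g n"
  by (simp add: ue_emb_def U_witt_lift_abs witt_e_def one)

lemma algebra_hom_U_witt_lift: "algebra_hom ue_const \<kappa> (U_witt_lift \<kappa> g)"
  unfolding algebra_hom_def
proof (intro conjI allI)
  fix x y :: "'k U_witt" and c :: 'k
  show "U_witt_lift \<kappa> g (x + y) = U_witt_lift \<kappa> g x + U_witt_lift \<kappa> g y"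
    by (induction x rule: U_witt.abs_induct, induction y rule: U_witt.abs_induct)
       (simp only: plus_U_witt.abs_eq U_witt_lift_abs free_lift_add)
  show "U_witt_lift \<kappa> g (x * y) = U_witt_lift \<kappa> g x * U_witt_lift \<kappa> g y"
    by (induction x rule: U_witt.abs_induct, induction y rule: U_witt.abs_induct)
       (simp only: times_U_witt.abs_eq U_witt_lift_abs free_lift_mult)
  show "U_witt_lift \<kappa> g 1 = 1"
    by (simp only: one_U_witt.abs_eq U_witt_lift_abs free_lift_1)
  show "U_witt_lift \<kappa> g (ue_const c) = \<kappa> c"
    by (simp only: ue_const.abs_eq U_witt_lift_abs free_lift_const)
qed

end

end

lemma algebra_hom_simps:
  assumes "algebra_hom \<kappa> \<kappa>' f"
  shows "f (x + y) = f x + f y" "f (x * y) = f x * f y" "f 1 = 1" "f (\<kappa> c) = \<kappa>' c"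
    "f 0 = 0" "f (x - y) = f x - f y"
proof -
  show add: "f (x + y) = f x + f y" for x y
    using assms by (simp add: algebra_hom_def)
  show "f (x * y) = f x * f y" "f 1 = 1" "f (\<kappa> c) = \<kappa>' c"
    using assms by (simp_all add: algebra_hom_def)
  show "f 0 = 0"
    using add[of 0 0] by simp
  show "f (x - y) = f x - f y"
    using add[of "x - y" y] by (simp add: algebra_simps)
qed


section \<open>First-order deformation of the tensor density modules\<close>

text \<open>The ring A[\<epsilon>]/(\<epsilon>^2) with \<epsilon> central. A homomorphism into it
  carries a representation together with its derivative, and multiplicativity is the product
  rule.\<close>

datatype 'a dual_number = Dual (std: 'a) (eps: 'a)

instantiation dual_number :: (ring_1) ring_1
begin

definition "0 = Dual 0 0"
definition "1 = Dual 1 0"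
definition "x + y = Dual (std x + std y) (eps x + eps y)"
definition "x - y = Dual (std x - std y) (eps x - eps y)"
definition "- x = Dual (- std x) (- eps x)"
definition "x * y = Dual (std x * std y) (std x * eps y + eps x * std y)"

instance
  by standard
    (simp_all add: zero_dual_number_def one_dual_number_def plus_dual_number_def
      minus_dual_number_def uminus_dual_number_def times_dual_number_def algebra_simps)

end

lemma dual_number_simps [simp]:
  "std 0 = 0" "std (x + y) = std x + std y" "std (x * y) = std x * std y"
  "eps 0 = 0" "eps (x + y) = eps x + eps y" "eps (x * y) = std x * eps y + eps x * std y"
  by (simp_all add: zero_dual_number_def plus_dual_number_def times_dual_number_def)

definition dual_const :: "'k::field \<Rightarrow> 'k shift_op dual_number" where
  "dual_const c = Dual (shift_const c) 0"

lemma algebra_struct_dual_const: "algebra_struct (dual_const :: 'k::field \<Rightarrow> 'k shift_op dual_number)"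
proof -
  interpret algebra_struct "shift_const :: 'k \<Rightarrow> 'k shift_op" by (rule algebra_struct_shift_const)
  show ?thesis
  proof
    show "dual_const c * x = x * dual_const c" for c and x :: "'k shift_op dual_number"
      by (simp add: dual_const_def times_dual_number_def central[of c "std x"] central[of c "eps x"])
  qed (simp_all add: dual_const_def one_dual_number_def plus_dual_number_def times_dual_number_def
      add mult one)
qed

lemma shift_weighted_plus:
  "shift_weighted d g + shift_weighted d g' = shift_weighted d (\<lambda>n. g n + g' n)"
proof (transfer, rule ext)
  fix d and g g' :: "int \<Rightarrow> 'k::field" and x
  show "shift_by d g x + shift_by d g' x = shift_by d (\<lambda>n. g n + g' n) x"
    by (induction x rule: poly_mapping_add_induct)
       (simp_all add: shift_by_add single_add[symmetric] algebra_simps)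
qed

lemma shift_const_eq: "shift_const c = shift_weighted 0 (\<lambda>_. c)"
proof (transfer, rule ext)
  fix c :: "'k::field" and x
  show "witt_scale c x = shift_by 0 (\<lambda>_. c) x"
    by (induction x rule: poly_mapping_add_induct) (simp_all add: shift_by_add witt_scale_add)
qed

text \<open>\<open>e\<^sub>n\<close> acts by \<open>t\<^sub>i \<mapsto> (i + (n - 1) (b + \<epsilon>)) t\<^sub>i\<^sub>+\<^sub>n\<close>; at \<open>\<epsilon> = 0\<close> this is \<open>\<lambda>\<^sub>a\<close> for \<open>b = 1 - a\<close>.\<close>

definition density :: "'k::field \<Rightarrow> int \<Rightarrow> 'k shift_op dual_number" where
  "density b n = Dual (shift_weighted n (\<lambda>i. of_int i + of_int (n - 1) * b))
     (shift_weighted n (\<lambda>_. of_int (n - 1)))"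

lemma density_mult:
  "density b n * density b m =
    Dual (shift_weighted (m + n) (\<lambda>i. (of_int (i + m) + of_int (n - 1) * b) * (of_int i + of_int (m - 1) * b)))
      (shift_weighted (m + n) (\<lambda>i. (of_int (i + m) + of_int (n - 1) * b) * of_int (m - 1)
        + of_int (n - 1) * (of_int i + of_int (m - 1) * b)))"
  by (simp add: density_def times_dual_number_def shift_weighted_mult shift_weighted_plus)

text \<open>The standard part is an identity polynomial in \<open>b\<close>; the \<epsilon> part is
  its derivative in \<open>b\<close>.\<close>

lemma density_commutator:
  "density b n * density b m - density b m * density b n = dual_const (of_int (m - n)) * density b (n + m)"
  unfolding density_mult
  by (simp add: density_def minus_dual_number_def times_dual_number_def dual_const_def
      shift_const_eq shift_weighted_mult shift_weighted_diff add.commute[of m n])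
    (simp add: algebra_simps)

section \<open>The deformed representation and the witnesses\<close>

definition deform :: "'k::field \<Rightarrow> 'k U_witt \<Rightarrow> 'k shift_op dual_number" where
  "deform b = U_witt_lift dual_const (density b)"

lemma algebra_hom_deform: "algebra_hom ue_const dual_const (deform b)"
  unfolding deform_def
  using algebra_struct_dual_const
  by (rule algebra_struct.algebra_hom_U_witt_lift) (rule density_commutator)

lemma deform_e: "deform b (ue_emb (witt_e n)) = density b n"
  unfolding deform_def
  using algebra_struct_dual_const
  by (rule algebra_struct.U_witt_lift_e) (rule density_commutator)

lemmas deform_simps = algebra_hom_simps[OF algebra_hom_deform] deform_e

lemmas lambda_hat_simps = algebra_hom_simps[OF algebra_hom_lambda_hat]

text \<open>On \<open>e_n\<close>: after v^(n-1), u has weight i + n - 1, and subtracting (n - 1) a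
  leaves i + (n - 1) (1 - a).\<close>

lemma std_deform: "std (deform (1 - a) x) = jl_rep (lambda_hat a x)"
proof (induction x rule: U_witt_induct)
  case (gen n)
  have "jl_rep ((jl_u - jl_const (of_int (n - 1) * a) * jl_v) * jl_vpow (n - 1))
    = jl_rep (jl_u * jl_vpow (n - 1)) - jl_rep (jl_const (of_int (n - 1) * a) * jl_v * jl_vpow (n - 1))"
    using jl_rep_add[of "(jl_u - jl_const (of_int (n - 1) * a) * jl_v) * jl_vpow (n - 1)"
        "jl_const (of_int (n - 1) * a) * jl_v * jl_vpow (n - 1)"]
    by (simp add: left_diff_distrib)
  also have "\<dots> = shift_weighted n (\<lambda>i. of_int i + of_int (n - 1) * (1 - a))"
    by (simp add: jl_rep_mult jl_rep_u jl_rep_v jl_rep_vpow jl_rep_const shift_const_eq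
        shift_weighted_mult shift_weighted_diff algebra_simps)
  finally show ?case
    by (simp add: lambda_hat_e deform_simps density_def)
qed (simp_all add: deform_simps lambda_hat_simps dual_const_def jl_rep_const jl_rep_add jl_rep_mult)

text \<open>The second difference in \<open>m\<close>, at \<open>m = 0\<close>, of \<open>e\<^sub>N\<^sub>-\<^sub>m e\<^sub>m\<close>, whose image is quadratic in \<open>m\<close> with
  \<open>b (1 - b)\<close> as the coefficient of \<open>m\<^sup>2\<close>.\<close>

definition witness :: "int \<Rightarrow> 'k::field U_witt" where
  "witness N = ue_emb (witt_e (N - 1)) * ue_emb (witt_e 1) + ue_emb (witt_e (N + 1)) * ue_emb (witt_e (- 1))
     - (ue_emb (witt_e N) * ue_emb (witt_e 0) + ue_emb (witt_e N) * ue_emb (witt_e 0))"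

text \<open>The standard weight 2 b (1 - b) vanishes at b = 0 and b = 1, while its derivative is 2
  and -2 there.\<close>

lemma deform_witness:
  "deform b (witness N) = Dual (shift_weighted N (\<lambda>_. 2 * (b * (1 - b)))) (shift_weighted N (\<lambda>_. 2 * (1 - 2 * b)))"
  unfolding witness_def deform_simps density_mult
  by (simp add: plus_dual_number_def minus_dual_number_def shift_weighted_plus shift_weighted_diff)
    (simp add: algebra_simps)

section \<open>Equality of the kernels\<close>

lemma ker_lambda_hat_eq:
  "ring_kernel (lambda_hat (0 :: 'k::field_char_0)) = ring_kernel (lambda_hat (1 :: 'k))"
proof -
  have "jl_u * lambda_hat (1 :: 'k) x = lambda_hat 0 x * jl_u" for x
  proof (induction x rule: U_witt_induct)
    case (const c)
    show ?case
      unfolding lambda_hat_simps by (rule algebra_struct.central[OF algebra_struct_jl_const, symmetric])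
  next
    case (gen n)
    \<comment> \<open>This identifies \<lambda>_1(e_n) with v^(n-1) u, so both sides become u
      v^(n-1) u.\<close>
    have "(jl_vpow (n - 1) :: 'k jordan_loc) * jl_u
        = (jl_u - jl_const (of_int (n - 1)) * jl_v) * jl_vpow (n - 1)"
      using jl_vpow_u[of "n - 1", where 'k = 'k]
      by (simp add: left_diff_distrib mult.assoc jl_v_vpow
          algebra_struct.of_int[OF algebra_struct_jl_const] del: of_int_diff)
    then show ?case
      by (simp add: lambda_hat_e mult.assoc algebra_struct.zero[OF algebra_struct_jl_const])
  next
    case (add x y)
    then show ?case by (simp add: lambda_hat_simps algebra_simps)
  next
    case (mult x y)
    then show ?case by (simp add: lambda_hat_simps) (metis mult.assoc)
  qed
  then show ?thesis
    \<comment> \<open>If \<lambda>_0(x) = 0, cancel u on the left of \<lambda>_1(x); if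
      \<lambda>_1(x) = 0, cancel u on the right of \<lambda>_0(x).\<close>
    unfolding ring_kernel_def
    by (metis jl_u_left_regular jl_u_right_regular mult_zero_left mult_zero_right)
qed

lemma witness_in_ker: "witness N \<in> ring_kernel (lambda_hat (0 :: 'k::field_char_0))"
proof -
  have "jl_rep (lambda_hat (0 :: 'k) (witness N)) = shift_weighted N (\<lambda>_. 0)"
    using std_deform[of "0 :: 'k" "witness N"] by (simp add: deform_witness)
  then have "lambda_hat (0 :: 'k) (witness N) = 0"
    by (intro jordan_loc_eq_0I) (simp add: entry_shift_weighted)
  then show ?thesis by (simp add: ring_kernel_def)
qed

section \<open>Invariant row, invariant column and row finiteness\<close>

lemma std_deform_ker:
  assumes "x \<in> ring_kernel (lambda_hat (0 :: 'k::field_char_0))" and "b \<in> {0, 1}"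
  shows "std (deform b x) = 0"
proof -
  \<comment> \<open>b = 1 gives \<lambda>_0 and b = 0 gives \<lambda>_1; equality of the kernels
    covers both.\<close>
  have "lambda_hat (1 - b) x = 0"
    using assms ker_lambda_hat_eq[where 'k = 'k] by (auto simp: ring_kernel_def)
  then show ?thesis
    using std_deform[of "1 - b" x] jl_rep_add[of "0 :: 'k jordan_loc" 0] by simp
qed

text \<open>At b = 1 the weight of \<open>e_n\<close> on t_i is i + n - 1, which is zero exactly
  when the target is t_1. So row 1 of every \<open>e_n\<close> vanishes, and only constants
  contribute to the scalar.\<close>

lemma row_1_deform: "\<exists>c. \<forall>y. Poly_Mapping.lookup (Rep_shift_op (std (deform 1 r)) y) 1 = c * Poly_Mapping.lookup y 1"
proof (induction r rule: U_witt_induct)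
  case (const c)
  show ?case by (auto simp: deform_simps dual_const_def Rep_shift_op_simps)
next
  case (gen n)
  have "Poly_Mapping.lookup (shift_by n (\<lambda>i. of_int i + of_int (n - 1) * 1) y) 1 = 0" for y :: "'a witt"
  proof (induction y rule: poly_mapping_add_induct)
    case (single i c)
    have "of_int i + (of_int n - 1) = (0 :: 'a)" if "i + n = 1"
      using that by (metis add_diff_eq diff_self of_int_1 of_int_add)
    then show ?case by (auto simp: lookup_single when_def)
  qed (simp add: shift_by_add lookup_add)
  then show ?case
    by (intro exI[of _ 0]) (simp add: deform_simps density_def Rep_shift_op_simps)
next
  case (add x y)
  then obtain c d where
    "\<forall>z. Poly_Mapping.lookup (Rep_shift_op (std (deform 1 x)) z) 1 = c * Poly_Mapping.lookup z 1"
    "\<forall>z. Poly_Mapping.lookup (Rep_shift_op (std (deform 1 y)) z) 1 = d * Poly_Mapping.lookup z 1"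
    by blast
  then show ?case
    by (intro exI[of _ "c + d"])
      (simp add: deform_simps Rep_shift_op_simps lookup_add distrib_right)
next
  case (mult x y)
  then obtain c d where
    "\<forall>z. Poly_Mapping.lookup (Rep_shift_op (std (deform 1 x)) z) 1 = c * Poly_Mapping.lookup z 1"
    "\<forall>z. Poly_Mapping.lookup (Rep_shift_op (std (deform 1 y)) z) 1 = d * Poly_Mapping.lookup z 1"
    by blast
  then show ?case
    by (intro exI[of _ "c * d"]) (simp add: deform_simps Rep_shift_op_simps mult.assoc)
qed

text \<open>At b = 0 the weight of \<open>e_n\<close> on t_i is i, so every \<open>e_n\<close> kills
  t_0.\<close>

lemma column_0_deform: "\<exists>c. Rep_shift_op (std (deform 0 r)) (witt_e 0) = witt_scale c (witt_e 0)"
proof (induction r rule: U_witt_induct)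
  case (const c)
  show ?case by (auto simp: deform_simps dual_const_def Rep_shift_op_simps)
next
  case (gen n)
  have "shift_by n w (witt_e 0) = witt_scale (w 0) (witt_e n)" for w :: "int \<Rightarrow> 'a"
    by (simp only: witt_e_def shift_by_single witt_scale_single add_0)
  then show ?case
    by (intro exI[of _ 0]) (simp add: deform_simps density_def Rep_shift_op_simps)
next
  case (add x y)
  then obtain c d where
    "Rep_shift_op (std (deform 0 x)) (witt_e 0) = witt_scale c (witt_e 0)"
    "Rep_shift_op (std (deform 0 y)) (witt_e 0) = witt_scale d (witt_e 0)"
    by blast
  then show ?case
    by (intro exI[of _ "c + d"])
      (simp add: deform_simps Rep_shift_op_simps witt.scale_left_distrib)
next
  case (mult x y)
  then obtain c d where
    "Rep_shift_op (std (deform 0 x)) (witt_e 0) = witt_scale c (witt_e 0)"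
    "Rep_shift_op (std (deform 0 y)) (witt_e 0) = witt_scale d (witt_e 0)"
    by blast
  then show ?case
    by (intro exI[of _ "d * c"]) (simp add: deform_simps Rep_shift_op_simps)
qed

text \<open>Not automatic, unlike finiteness of columns: an operator may send every t_i to t_0. It
  bounds row 1 of the generators of a left ideal.\<close>

definition row_finite :: "'k::field shift_op \<Rightarrow> bool" where
  "row_finite f \<longleftrightarrow> (\<forall>j. finite {i. entry f j i \<noteq> 0})"

lemma row_finite_add: "row_finite f \<Longrightarrow> row_finite g \<Longrightarrow> row_finite (f + g)"
  unfolding row_finite_def
proof
  fix j
  assume "\<forall>j. finite {i. entry f j i \<noteq> 0}" "\<forall>j. finite {i. entry g j i \<noteq> 0}"
  then have "finite ({i. entry f j i \<noteq> 0} \<union> {i. entry g j i \<noteq> 0})"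
    by simp
  then show "finite {i. entry (f + g) j i \<noteq> 0}"
    by (rule finite_subset[rotated]) (auto simp: entry_add)
qed

text \<open>Row j of the product is a combination of the finitely many rows of \<open>g\<close>
  selected by row j of \<open>f\<close>.\<close>

lemma row_finite_mult: "row_finite f \<Longrightarrow> row_finite g \<Longrightarrow> row_finite (f * g)"
  unfolding row_finite_def
proof
  fix j
  assume "\<forall>j. finite {i. entry f j i \<noteq> 0}" "\<forall>j. finite {i. entry g j i \<noteq> 0}"
  then have "finite (\<Union>k\<in>{k. entry f j k \<noteq> 0}. {i. entry g k i \<noteq> 0})"
    by simp
  moreover have "{i. entry (f * g) j i \<noteq> 0} \<subseteq> (\<Union>k\<in>{k. entry f j k \<noteq> 0}. {i. entry g k i \<noteq> 0})"
  proof
    fix i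
    assume "i \<in> {i. entry (f * g) j i \<noteq> 0}"
    then obtain k where "entry f j k * entry g k i \<noteq> 0"
      using sum.not_neutral_contains_not_neutral[of "\<lambda>k. entry f j k * entry g k i"]
      unfolding entry_mult by blast
    then show "i \<in> (\<Union>k\<in>{k. entry f j k \<noteq> 0}. {i. entry g k i \<noteq> 0})"
      by auto
  qed
  ultimately show "finite {i. entry (f * g) j i \<noteq> 0}"
    by (rule finite_subset[rotated])
qed

lemma row_finite_shift_weighted: "row_finite (shift_weighted d w)"
  unfolding row_finite_def
proof
  fix j
  show "finite {i. entry (shift_weighted d w) j i \<noteq> 0}"
    by (rule finite_subset[of _ "{j - d}"]) (auto simp: entry_shift_weighted)
qed

lemma row_finite_deform: "row_finite (std (deform b x)) \<and> row_finite (eps (deform b x))"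
proof (induction x rule: U_witt_induct)
  case (const c)
  have "row_finite 0" by (simp add: row_finite_def entry_0)
  then show ?case
    by (simp add: deform_simps dual_const_def shift_const_eq row_finite_shift_weighted)
qed (simp_all add: deform_simps density_def row_finite_shift_weighted row_finite_add row_finite_mult)

section \<open>Failure of finite generation\<close>

lemma ker_not_fin_gen_left:
  "\<not> fin_gen_left_ideal (ring_kernel (lambda_hat (0 :: 'k::field_char_0)))"
proof
  let ?K = "ring_kernel (lambda_hat (0 :: 'k))"
  assume "fin_gen_left_ideal ?K"
  then obtain S where S: "finite S" "?K = left_ideal hull S"
    unfolding fin_gen_left_ideal_def by blast
  define T where "T = (\<Union>s\<in>S. {i. entry (eps (deform 1 s)) 1 i \<noteq> 0})"
  define L where "L = {x \<in> ?K. \<forall>i. i \<notin> T \<longrightarrow> entry (eps (deform 1 x)) 1 i = 0}"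
  have "finite T"
    using S(1) row_finite_deform by (auto simp: T_def row_finite_def)
  then have "finite ((\<lambda>i. 1 - i) ` T)" by simp
  \<comment> \<open>The shift by N meets row 1 in column 1 - N, which has to avoid
    \<open>T\<close>.\<close>
  then obtain N where N: "N \<notin> (\<lambda>i. 1 - i) ` T"
    using ex_new_if_finite infinite_UNIV_int by blast
  then have "1 - N \<notin> T" by force
  have "left_ideal L"
    unfolding left_ideal_def
  proof (intro conjI ballI allI)
    show "0 \<in> L"
      by (simp add: L_def ring_kernel_def lambda_hat_simps deform_simps entry_0)
    show "x + y \<in> L" if "x \<in> L" "y \<in> L" for x y
      using that by (simp add: L_def ring_kernel_def lambda_hat_simps deform_simps entry_add)
    show "r * x \<in> L" if "x \<in> L" for r x
    proof -
      have x: "x \<in> ?K" using that by (simp add: L_def)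
      then have "std (deform 1 x) = 0" by (rule std_deform_ker) simp
      \<comment> \<open>The other term of the product rule contains \<open>std (deform 1 x)\<close>.
        What remains only rescales row 1, so its support stays in \<open>T\<close>.\<close>
      then have "eps (deform 1 (r * x)) = std (deform 1 r) * eps (deform 1 x)"
        by (simp add: deform_simps)
      moreover obtain c where
        "\<forall>y. Poly_Mapping.lookup (Rep_shift_op (std (deform 1 r)) y) 1 = c * Poly_Mapping.lookup y 1"
        using row_1_deform[of r] by blast
      ultimately have "entry (eps (deform 1 (r * x))) 1 i = c * entry (eps (deform 1 x)) 1 i" for i
        by (simp add: entry_def Rep_shift_op_simps)
      then show ?thesis
        using that x by (simp add: L_def ring_kernel_def lambda_hat_simps)
    qed
  qed
  moreover have "S \<subseteq> L"
    using hull_subset[of S left_ideal] by (auto simp: L_def T_def S(2))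
  ultimately have "?K \<subseteq> L"
    unfolding S(2) by (intro hull_minimal)
  then have "witness N \<in> L" using witness_in_ker by blast
  then have "entry (eps (deform (1 :: 'k) (witness N))) 1 (1 - N) = 0"
    using \<open>1 - N \<notin> T\<close> by (simp add: L_def)
  then show False
    by (simp add: deform_witness entry_shift_weighted)
qed

lemma ker_not_fin_gen_right:
  "\<not> fin_gen_right_ideal (ring_kernel (lambda_hat (0 :: 'k::field_char_0)))"
proof
  let ?K = "ring_kernel (lambda_hat (0 :: 'k))"
  assume "fin_gen_right_ideal ?K"
  then obtain S where S: "finite S" "?K = right_ideal hull S"
    unfolding fin_gen_right_ideal_def by blast
  define T where "T = (\<Union>s\<in>S. {j. entry (eps (deform 0 s)) j 0 \<noteq> 0})"
  define L where "L = {x \<in> ?K. \<forall>j. j \<notin> T \<longrightarrow> entry (eps (deform 0 x)) j 0 = 0}"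
  \<comment> \<open>Column 0 is the image of t_0, a finitely supported vector.\<close>
  have "finite T"
    using S(1) by (simp add: T_def entry_def flip: in_keys_iff)
  \<comment> \<open>The shift by N meets column 0 in row N, with entry 2 at b = 0.\<close>
  then obtain N where "N \<notin> T"
    using ex_new_if_finite infinite_UNIV_int by blast
  have "right_ideal L"
    unfolding right_ideal_def
  proof (intro conjI ballI allI)
    show "0 \<in> L"
      by (simp add: L_def ring_kernel_def lambda_hat_simps deform_simps entry_0)
    show "x + y \<in> L" if "x \<in> L" "y \<in> L" for x y
      using that by (simp add: L_def ring_kernel_def lambda_hat_simps deform_simps entry_add)
    show "x * r \<in> L" if "x \<in> L" for r x
    proof -
      have x: "x \<in> ?K" using that by (simp add: L_def)
      then have "std (deform 0 x) = 0" by (rule std_deform_ker) simp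
      then have "eps (deform 0 (x * r)) = eps (deform 0 x) * std (deform 0 r)"
        by (simp add: deform_simps)
      moreover obtain c where
        "Rep_shift_op (std (deform 0 r)) (witt_e 0) = witt_scale c (witt_e 0)"
        using column_0_deform[of r] by blast
      ultimately have "entry (eps (deform 0 (x * r))) j 0 = c * entry (eps (deform 0 x)) j 0" for j
        by (simp add: entry_def Rep_shift_op_simps)
      then show ?thesis
        using that x by (simp add: L_def ring_kernel_def lambda_hat_simps)
    qed
  qed
  moreover have "S \<subseteq> L"
    using hull_subset[of S right_ideal] by (auto simp: L_def T_def S(2))
  ultimately have "?K \<subseteq> L"
    unfolding S(2) by (intro hull_minimal)
  then have "witness N \<in> L" using witness_in_ker by blast
  then have "entry (eps (deform (0 :: 'k) (witness N))) N 0 = 0"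
    using \<open>N \<notin> T\<close> by (simp add: L_def)
  then show False
    by (simp add: deform_witness entry_shift_weighted)
qed

theorem theorem0p8:
  shows "ring_kernel (lambda_hat (0 :: 'k::field_char_0)) = ring_kernel (lambda_hat (1 :: 'k))
    \<and> \<not> fin_gen_left_ideal (ring_kernel (lambda_hat (0 :: 'k)))
    \<and> \<not> fin_gen_right_ideal (ring_kernel (lambda_hat (0 :: 'k)))"
  using ker_lambda_hat_eq ker_not_fin_gen_left ker_not_fin_gen_right by blast

end
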